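(* Let $a,m\ge2$ be integers with $m$ even (and $m\le n$). Then $$R_{(a\,1^{m-1})}=(R_{(1)}-1)(R_{(1)}-2)\cdots(R_{(1)}-a+2)\Big(R_{(1)}R_{(1^m)}-\frac{a-1}{a-1+mr}\,R_{(1^{m+1})}\Big).$$
   Context: Let $k$ be a field of characteristic zero, $n\ge 1$, $\mathcal P=k[z_1,\dots,z_n]$, and let $W\subseteq S_n$ be the group of permutations $\pi$ with $\pi(i)\equiv i \bmod 2$ for all $i$, acting by permuting variables. $\Lambda$ is the set of integer tuples $\lambda=(\lambda_1\ge\dots\ge\lambda_n\ge 0)$ and $|\lambda|_{\rm odd}=\sum_{i\text{ odd}}\lambda_i$. Fix $r\in k$ which is not a negative rational number and put $\rho=((n-1)r,(n-2)r,\dots,r,0)$. For $\lambda\in\Lambda$ let $[\lambda]_m=\lambda_m-\lambda_{m+1}+\dots+(-1)^{n-m}\lambda_n$. $R_\lambda=R_\lambda(z;r)\in\mathcal P^W$ is the unique $W$-invariant polynomial of degree $|\lambda|_{\rm odd}$ which satisfies $R_\lambda(\rho+\mu)=0$ for all $\mu\in\Lambda$ with $|\mu|_{\rm odd}\le|\lambda|_{\rm odd}$, $\mu\ne\lambda$, and in which the monomial $z^{[\lambda]}$ has coefficient $1$ (it is known that this exists and is unique). Convention: $R_{(1^{m+1})}=0$ if $m+1>n$. $(a\,1^{m-1})\in\Lambda$ is the partition $(a,1,\dots,1,0,\dots,0)$ with $m-1$ ones; $(1^m)$ has $m$ ones; $(1)=(1,0,\dots,0)$. For $a=2$ the product preceding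 the large parenthesis is empty, i.e. equal to $1$. *)

theory Defs
  imports Complex_Main "HOL-Library.Poly_Mapping" "HOL-Combinatorics.Permutations"
begin

text \<open>
  Polynomials in variables \<open>z\<^sub>i\<close> indexed by natural numbers are finitely supported functions from
  exponent vectors to coefficients, with the ring structure of \<^theory>\<open>HOL-Library.Poly_Mapping\<close>.
  The ring in \<open>z\<^sub>1, \<dots>, z\<^sub>n\<close> is the subset \<open>poly_ring n\<close>.
\<close>

type_synonym 'a mpol = "(nat \<Rightarrow>\<^sub>0 nat) \<Rightarrow>\<^sub>0 'a"

definition poly_ring :: "nat \<Rightarrow> 'a::zero mpol set" where
  "poly_ring n = {p. \<forall>\<alpha>\<in>Poly_Mapping.keys p. Poly_Mapping.keys \<alpha> \<subseteq> {1..n}}"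

definition const :: "'a::zero \<Rightarrow> 'a mpol" where
  "const c = Poly_Mapping.single 0 c"

definition poly_eval :: "'a::comm_semiring_1 mpol \<Rightarrow> (nat \<Rightarrow> 'a) \<Rightarrow> 'a" where
  "poly_eval p x = (\<Sum>\<alpha>\<in>Poly_Mapping.keys p. Poly_Mapping.lookup p \<alpha> *
     (\<Prod>i\<in>Poly_Mapping.keys \<alpha>. x i ^ Poly_Mapping.lookup \<alpha> i))"

text \<open>The zero polynomial is given degree 0.\<close>

definition total_degree :: "'a::zero mpol \<Rightarrow> nat" where
  "total_degree p = Max (insert 0
     ((\<lambda>\<alpha>. \<Sum>i\<in>Poly_Mapping.keys \<alpha>. Poly_Mapping.lookup \<alpha> i) ` Poly_Mapping.keys p))"

text \<open>
  For a permutation \<open>\<pi>\<close>, the coefficient of \<open>z\<^sup>\<alpha>\<close> in \<open>permute_vars \<pi> p\<close> is the coefficient of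
  \<open>z\<^bsup>\<alpha> \<circ> \<pi>\<^esup>\<close> in \<open>p\<close>; that is,
  \<open>permute_vars \<pi>\<close> substitutes \<open>z\<^bsub>\<pi> i\<^esub>\<close> for \<open>z\<^sub>i\<close>.
\<close>

definition permute_vars :: "(nat \<Rightarrow> nat) \<Rightarrow> 'a::zero mpol \<Rightarrow> 'a mpol" where
  "permute_vars \<pi> p = Poly_Mapping.map_key (Poly_Mapping.map_key \<pi>) p"

lemma lookup_permute_vars:
  assumes "\<pi> permutes S"
  shows "Poly_Mapping.lookup (permute_vars \<pi> p) \<alpha> = Poly_Mapping.lookup p (Poly_Mapping.map_key \<pi> \<alpha>)"
    and "Poly_Mapping.lookup (Poly_Mapping.map_key \<pi> \<alpha>) i = Poly_Mapping.lookup \<alpha> (\<pi> i)"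
proof -
  have inj: "inj \<pi>" and surj: "surj \<pi>"
    using assms permutes_inj permutes_surj by blast+
  show key: "Poly_Mapping.lookup (Poly_Mapping.map_key \<pi> \<alpha>) i = Poly_Mapping.lookup \<alpha> (\<pi> i)"
    for \<alpha> :: "nat \<Rightarrow>\<^sub>0 nat" and i
    by (simp add: map_key.rep_eq[OF inj])
  have "inj (Poly_Mapping.map_key \<pi> :: (nat \<Rightarrow>\<^sub>0 nat) \<Rightarrow> _)"
  proof (rule injI)
    fix \<alpha> \<beta> :: "nat \<Rightarrow>\<^sub>0 nat"
    assume eq: "Poly_Mapping.map_key \<pi> \<alpha> = Poly_Mapping.map_key \<pi> \<beta>"
    show "\<alpha> = \<beta>"
    proof (rule poly_mapping_eqI)
      fix k
      obtain i where "k = \<pi> i" using surj by (rule surjE)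
      then show "Poly_Mapping.lookup \<alpha> k = Poly_Mapping.lookup \<beta> k"
        using arg_cong[OF eq, of "\<lambda>\<gamma>. Poly_Mapping.lookup \<gamma> i"] by (simp add: key)
    qed
  qed
  then show "Poly_Mapping.lookup (permute_vars \<pi> p) \<alpha> = Poly_Mapping.lookup p (Poly_Mapping.map_key \<pi> \<alpha>)"
    by (simp add: permute_vars_def map_key.rep_eq)
qed

definition parity_perms :: "nat \<Rightarrow> (nat \<Rightarrow> nat) set" where
  "parity_perms n = {\<pi>. \<pi> permutes {1..n} \<and> (\<forall>i\<in>{1..n}. \<pi> i mod 2 = i mod 2)}"

definition invariants :: "nat \<Rightarrow> 'a::zero mpol set" where
  "invariants n = {p \<in> poly_ring n. \<forall>\<pi>\<in>parity_perms n. permute_vars \<pi> p = p}"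

text \<open>
  Tuples \<open>(\<lambda>\<^sub>1, \<dots>, \<lambda>\<^sub>n)\<close> are functions on \<^typ>\<open>nat\<close> that vanish outside \<open>{1..n}\<close>, so that
  equality of functions is equality of tuples.
\<close>

definition Lambda :: "nat \<Rightarrow> (nat \<Rightarrow> nat) set" where
  "Lambda n = {l. (\<forall>i. i \<notin> {1..n} \<longrightarrow> l i = 0) \<and> (\<forall>i\<in>{1..<n}. l (Suc i) \<le> l i)}"

definition odd_size :: "nat \<Rightarrow> (nat \<Rightarrow> nat) \<Rightarrow> nat" where
  "odd_size n l = (\<Sum>i | i \<in> {1..n} \<and> odd i. l i)"

definition bracket :: "nat \<Rightarrow> (nat \<Rightarrow> nat) \<Rightarrow> nat \<Rightarrow> int" where
  "bracket n l m = (\<Sum>j=m..n. (-1) ^ (j - m) * int (l j))"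

text \<open>For \<open>l \<in> Lambda n\<close> the alternating sums are nonnegative, so \<open>nat\<close> truncates nothing.\<close>

lemma bracket_nonneg:
  assumes "l \<in> Lambda n" and "1 \<le> m"
  shows "0 \<le> bracket n l m"
proof -
  have rec: "bracket n l k = int (l k) - bracket n l (Suc k)" if "k \<le> n" for k
  proof -
    have "(\<Sum>j=Suc k..n. (-1) ^ (j - k) * int (l j)) =
          (\<Sum>j=Suc k..n. - ((-1) ^ (j - Suc k) * int (l j)))"
    proof (rule sum.cong)
      fix j assume "j \<in> {Suc k..n}"
      then have "j - k = Suc (j - Suc k)" by auto
      then show "(-1) ^ (j - k) * int (l j) = - ((-1) ^ (j - Suc k) * int (l j))" by simp
    qed simp
    then show ?thesis
      using that by (simp add: bracket_def sum.atLeast_Suc_atMost sum_negf)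
  qed
  have "0 \<le> bracket n l m \<and> bracket n l m \<le> int (l m)"
    using assms(2)
  proof (induction "Suc n - m" arbitrary: m)
    case 0
    then show ?case by (simp add: bracket_def)
  next
    case (Suc d)
    then have m: "m \<le> n" and IH: "0 \<le> bracket n l (Suc m)" "bracket n l (Suc m) \<le> int (l (Suc m))"
      using Suc.hyps(1)[of "Suc m"] by auto
    have "l (Suc m) \<le> l m"
      using assms(1) m Suc.prems by (cases "m = n") (auto simp: Lambda_def)
    then show ?case using IH rec[OF m] by simp
  qed
  then show ?thesis ..
qed

definition bracket_exponent :: "nat \<Rightarrow> (nat \<Rightarrow> nat) \<Rightarrow> nat \<Rightarrow>\<^sub>0 nat" where
  "bracket_exponent n l = (\<Sum>m=1..n. Poly_Mapping.single m (nat (bracket n l m)))"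

definition rho :: "nat \<Rightarrow> 'a::comm_semiring_1 \<Rightarrow> nat \<Rightarrow> 'a" where
  "rho n r i = of_nat (n - i) * r"

definition is_semisym :: "nat \<Rightarrow> 'a::field_char_0 \<Rightarrow> (nat \<Rightarrow> nat) \<Rightarrow> 'a mpol \<Rightarrow> bool" where
  "is_semisym n r l p \<longleftrightarrow>
     p \<in> invariants n \<and>
     total_degree p = odd_size n l \<and>
     (\<forall>\<mu>\<in>Lambda n. odd_size n \<mu> \<le> odd_size n l \<and> \<mu> \<noteq> l \<longrightarrow>
        poly_eval p (\<lambda>i. rho n r i + of_nat (\<mu> i)) = 0) \<and>
     Poly_Mapping.lookup p (bracket_exponent n l) = 1"

text \<open>
  The polynomial \<open>R\<^sub>\<lambda>(z; r)\<close>. The case \<open>l \<notin> Lambda n\<close> implements the convention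
  \<open>R\<^bsub>(1\<^bsup>m+1\<^esup>)\<^esub> = 0\<close> for \<open>m + 1 > n\<close>.
\<close>

definition R :: "nat \<Rightarrow> 'a::field_char_0 \<Rightarrow> (nat \<Rightarrow> nat) \<Rightarrow> 'a mpol" where
  "R n r l = (if l \<in> Lambda n then THE p. is_semisym n r l p else 0)"

definition hook :: "nat \<Rightarrow> nat \<Rightarrow> nat \<Rightarrow> nat" where
  "hook a b = (\<lambda>i. if i = 1 then a else if 2 \<le> i \<and> i \<le> b + 1 then 1 else 0)"

definition column :: "nat \<Rightarrow> nat \<Rightarrow> nat" where
  "column b = (\<lambda>i. if 1 \<le> i \<and> i \<le> b then 1 else 0)"

end

theory Submission
  imports Defs "HOL-Computational_Algebra.Polynomial"
begin

text \<open>
  The defining properties of \<open>R\<^sub>\<lambda>\<close> determine it: a \<open>W\<close>-invariant polynomial of degree at most \<open>d\<close>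
  that vanishes at \<open>\<rho> + \<mu>\<close> for all \<open>\<mu>\<close> with \<open>|\<mu>|\<^sub>o\<^sub>d\<^sub>d \<le> d\<close> is zero (\<open>vanishing_imp_zero\<close>). Indeed its
  restriction to \<open>z\<^sub>n = 0\<close> is zero by induction on \<open>n\<close>, so by invariance it is divisible by
  \<open>\<Prod>\<^bsub>i \<equiv> n\<^esub> z\<^sub>i\<close>, and the quotient is of the same kind with smaller \<open>d\<close> after a shift by \<open>(1\<^sup>n)\<close>; the factors
  \<open>z\<^sub>i\<close> are nonzero at the points with \<open>\<mu>\<^sub>n \<ge> 1\<close> since \<open>r\<close> is not a negative rational. Hence
  it suffices to show that the right-hand side has the required invariance, degree, zeros and
  leading coefficient (\<open>R_eqI\<close>).

  For columns there are explicit formulas. Let \<open>E\<^sub>k\<close> and \<open>O\<^sub>k\<close> be the sums over all \<open>k\<close>-element sets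
  \<open>I\<close> of even, respectively odd, indices of \<open>\<Prod>\<^bsub>i\<in>I\<^esub> (z\<^sub>i - \<rho>\<^sub>i + 2r |{u \<in> I. u > i}|)\<close>. These are
  symmetric in the variables that they contain, and their values at \<open>\<rho> + \<mu>\<close> involve only subsets
  \<open>I\<close> of the support of \<open>\<mu>\<close>. It follows that \<open>R\<close> of \<open>(1\<^bsup>2k\<^esup>)\<close> is \<open>E\<^sub>k\<close> (\<open>R_column_even\<close>) and that
  \<open>R\<close> of \<open>(1\<^bsup>2k+1\<^esup>)\<close> is \<open>O\<^bsub>k+1\<^esub> - E\<^bsub>k+1\<^esub>\<close> (\<open>R_column_odd\<close>). In particular the value of \<open>R\<close> of \<open>(1)\<close>
  at \<open>\<rho> + \<mu>\<close> is the nonnegative integer \<open>gap\<close>, the sum of the odd parts of \<open>\<mu>\<close> minus the sum of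
  its even parts.

  Now let \<open>m = 2k\<close>, \<open>\<lambda> = (a 1\<^bsup>m-1\<^esup>)\<close> and \<open>|\<mu>|\<^sub>o\<^sub>d\<^sub>d \<le> |\<lambda>|\<^sub>o\<^sub>d\<^sub>d = a - 1 + k\<close>. If \<open>\<mu>\<^sub>m = 0\<close>, the polynomials of
  both columns \<open>(1\<^sup>m)\<close> and \<open>(1\<^bsup>m+1\<^esup>)\<close> vanish at \<open>\<mu>\<close>. Otherwise the even parts sum to at least \<open>k\<close>,
  so that \<open>gap \<le> a - 1\<close>. If \<open>gap = 0\<close>, the odd and the even parts coincide and \<open>O\<^bsub>k+1\<^esub> - E\<^bsub>k+1\<^esub>\<close>
  vanishes; if \<open>1 \<le> gap \<le> a - 2\<close>, one of the linear factors vanishes; and if \<open>gap = a - 1\<close>, then \<open>\<mu>\<close>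
  is \<open>\<lambda>\<close> or \<open>(a-1, 1\<^sup>m)\<close> (\<open>Lambda_hook_cases\<close>). At the last point the polynomial of \<open>(1\<^bsup>m+1\<^esup>)\<close> is
  \<open>a - 1 + m r\<close> times that of \<open>(1\<^sup>m)\<close> (\<open>shifted_value_hook\<close>), and the coefficient in the theorem is
  the one that makes the parenthesis vanish. The coefficient of \<open>z\<^bsup>[\<lambda>]\<^esup>\<close> is found by comparing
  lexicographic leading monomials.
\<close>

abbreviation (input) "lookup \<equiv> Poly_Mapping.lookup"
abbreviation (input) "keys \<equiv> Poly_Mapping.keys"
abbreviation (input) "single \<equiv> Poly_Mapping.single"

section \<open>Exponents and evaluation\<close>

definition mdeg :: "(nat \<Rightarrow>\<^sub>0 nat) \<Rightarrow> nat" where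
  "mdeg \<alpha> = (\<Sum>i\<in>keys \<alpha>. lookup \<alpha> i)"

definition monom_eval :: "(nat \<Rightarrow>\<^sub>0 nat) \<Rightarrow> (nat \<Rightarrow> 'a::comm_semiring_1) \<Rightarrow> 'a" where
  "monom_eval \<alpha> x = (\<Prod>i\<in>keys \<alpha>. x i ^ lookup \<alpha> i)"

lemma mdeg_superset:
  assumes "finite V" "keys \<alpha> \<subseteq> V"
  shows "mdeg \<alpha> = (\<Sum>i\<in>V. lookup \<alpha> i)"
  unfolding mdeg_def by (rule sum.mono_neutral_left) (use assms in \<open>auto simp: in_keys_iff\<close>)

lemma monom_eval_superset:
  assumes "finite V" "keys \<alpha> \<subseteq> V"
  shows "monom_eval \<alpha> x = (\<Prod>i\<in>V. x i ^ lookup \<alpha> i)"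
  unfolding monom_eval_def by (rule prod.mono_neutral_left) (use assms in \<open>auto simp: in_keys_iff\<close>)

lemma keys_add_exponent: "keys (\<alpha> + \<beta>) = keys \<alpha> \<union> keys (\<beta> :: nat \<Rightarrow>\<^sub>0 nat)"
  by (auto simp: in_keys_iff lookup_add)

lemma mdeg_add: "mdeg (\<alpha> + \<beta>) = mdeg \<alpha> + mdeg \<beta>"
proof -
  let ?V = "keys \<alpha> \<union> keys \<beta>"
  have "mdeg (\<alpha> + \<beta>) = (\<Sum>i\<in>?V. lookup (\<alpha> + \<beta>) i)"
    by (rule mdeg_superset) (auto simp: keys_add_exponent)
  moreover have "mdeg \<alpha> = (\<Sum>i\<in>?V. lookup \<alpha> i)" "mdeg \<beta> = (\<Sum>i\<in>?V. lookup \<beta> i)"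
    by (rule mdeg_superset; auto)+
  ultimately show ?thesis by (simp add: lookup_add sum.distrib)
qed

lemma mdeg_zero [simp]: "mdeg 0 = 0" and mdeg_single [simp]: "mdeg (single i c) = c"
  by (simp_all add: mdeg_def)

lemma monom_eval_add: "monom_eval (\<alpha> + \<beta>) x = monom_eval \<alpha> x * monom_eval \<beta> x"
proof -
  let ?V = "keys \<alpha> \<union> keys \<beta>"
  have "monom_eval (\<alpha> + \<beta>) x = (\<Prod>i\<in>?V. x i ^ lookup (\<alpha> + \<beta>) i)"
    by (rule monom_eval_superset) (auto simp: keys_add_exponent)
  moreover have "monom_eval \<alpha> x = (\<Prod>i\<in>?V. x i ^ lookup \<alpha> i)"
    "monom_eval \<beta> x = (\<Prod>i\<in>?V. x i ^ lookup \<beta> i)"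
    by (rule monom_eval_superset; auto)+
  ultimately show ?thesis by (simp add: lookup_add power_add prod.distrib)
qed

lemma monom_eval_zero [simp]: "monom_eval 0 x = 1"
  and monom_eval_single [simp]: "monom_eval (single i c) x = x i ^ c"
  by (simp_all add: monom_eval_def)

lemma poly_eval_superset:
  assumes "finite S" "keys p \<subseteq> S"
  shows "poly_eval p x = (\<Sum>\<alpha>\<in>S. lookup p \<alpha> * monom_eval \<alpha> x)"
  unfolding poly_eval_def monom_eval_def
  by (rule sum.mono_neutral_left) (use assms in \<open>auto simp: in_keys_iff\<close>)

lemma poly_eval_monom_eval: "poly_eval p x = (\<Sum>\<alpha>\<in>keys p. lookup p \<alpha> * monom_eval \<alpha> x)"
  by (simp add: poly_eval_superset)

lemma poly_eval_zero [simp]: "poly_eval 0 x = 0"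
  by (simp add: poly_eval_def)

lemma poly_eval_single [simp]: "poly_eval (single \<alpha> c) x = c * monom_eval \<alpha> x"
  by (simp add: poly_eval_monom_eval)

lemma poly_eval_const [simp]: "poly_eval (const c) x = c"
  by (simp add: const_def)

lemma poly_eval_add [simp]: "poly_eval (p + q) x = poly_eval p x + poly_eval q x"
proof -
  let ?S = "keys p \<union> keys q"
  have "poly_eval (p + q) x = (\<Sum>\<alpha>\<in>?S. lookup (p + q) \<alpha> * monom_eval \<alpha> x)"
    by (rule poly_eval_superset) (use keys_add[of p q] in auto)
  then show ?thesis
    by (simp add: lookup_add sum.distrib distrib_right poly_eval_superset[of ?S p] poly_eval_superset[of ?S q])
qed

lemma poly_eval_sum [simp]: "poly_eval (sum f A) x = (\<Sum>i\<in>A. poly_eval (f i) x)"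
  by (induction A rule: infinite_finite_induct) simp_all

lemma poly_mapping_sum_single: "p = (\<Sum>\<alpha>\<in>keys p. single \<alpha> (lookup p \<alpha>))"
proof (rule poly_mapping_eqI)
  fix \<beta>
  have "lookup (\<Sum>\<alpha>\<in>keys p. single \<alpha> (lookup p \<alpha>)) \<beta> = (\<Sum>\<alpha>\<in>keys p. if \<alpha> = \<beta> then lookup p \<alpha> else 0)"
    by (simp add: lookup_sum lookup_single when_def)
  also have "\<dots> = lookup p \<beta>"
    by (simp add: in_keys_iff)
  finally show "lookup p \<beta> = lookup (\<Sum>\<alpha>\<in>keys p. single \<alpha> (lookup p \<alpha>)) \<beta>" ..
qed

lemma poly_eval_mult [simp]: "poly_eval (p * q) x = poly_eval p x * poly_eval q x"
proof -
  have "p * q = (\<Sum>\<alpha>\<in>keys p. single \<alpha> (lookup p \<alpha>)) * (\<Sum>\<beta>\<in>keys q. single \<beta> (lookup q \<beta>))"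
    using poly_mapping_sum_single[of p] poly_mapping_sum_single[of q] by simp
  also have "\<dots> = (\<Sum>\<alpha>\<in>keys p. \<Sum>\<beta>\<in>keys q. single (\<alpha> + \<beta>) (lookup p \<alpha> * lookup q \<beta>))"
    by (simp add: sum_product mult_single)
  finally show ?thesis
    by (simp add: monom_eval_add poly_eval_monom_eval[of p] poly_eval_monom_eval[of q] sum_product mult_ac)
qed

lemma poly_eval_one [simp]: "poly_eval 1 x = 1"
  by (simp flip: single_one)

lemma poly_eval_prod [simp]: "poly_eval (prod f A) x = (\<Prod>i\<in>A. poly_eval (f i) x)"
  by (induction A rule: infinite_finite_induct) simp_all

lemma poly_eval_power [simp]: "poly_eval (p ^ k) x = poly_eval p x ^ k"
  by (induction k) simp_all

lemma poly_eval_diff [simp]: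
  "poly_eval (p - q) x = poly_eval p x - poly_eval q (x :: nat \<Rightarrow> 'a::comm_ring_1)"
  using poly_eval_add[of "p - q" q x] by (simp del: poly_eval_add)

lemma poly_eval_of_nat [simp]: "poly_eval (of_nat k) x = of_nat k"
  by (simp flip: single_of_nat)

lemma poly_eval_cong:
  assumes "p \<in> poly_ring n" "\<And>i. i \<in> {1..n} \<Longrightarrow> x i = y i"
  shows "poly_eval p x = poly_eval p y"
  unfolding poly_eval_def using assms by (intro sum.cong prod.cong refl arg_cong2[of _ _ _ _ "(*)"])
    (force simp: poly_ring_def)

section \<open>A polynomial is determined by its values\<close>

text \<open>
  Induction on the number of variables: grouped by the exponent of the last variable, a vanishing
  sum becomes a univariate polynomial in that variable with infinitely many zeros, so each of its
  coefficients, a sum of monomials in fewer variables, vanishes identically.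
\<close>

lemma monomials_independent:
  fixes c :: "(nat \<Rightarrow>\<^sub>0 nat) \<Rightarrow> 'a::field_char_0"
  assumes "finite S" "\<And>\<alpha>. \<alpha> \<in> S \<Longrightarrow> keys \<alpha> \<subseteq> {1..n}"
    and "\<And>x. (\<Sum>\<alpha>\<in>S. c \<alpha> * monom_eval \<alpha> x) = 0" and "\<alpha> \<in> S"
  shows "c \<alpha> = 0"
  using assms
proof (induction n arbitrary: S c \<alpha>)
  case 0
  then have "S \<subseteq> {0}" by (fastforce simp: in_keys_iff intro: poly_mapping_eqI)
  with 0(4) have "S = {0}" "\<alpha> = 0" by auto
  with 0(3) show ?case by simp
next
  case (Suc n)
  define drop where "drop = Poly_Mapping.update (Suc n) (0::nat)"
  define N where "N = Max ((\<lambda>\<beta>. lookup \<beta> (Suc n)) ` S)"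
  define slice where "slice j = {\<beta>\<in>S. lookup \<beta> (Suc n) = j}" for j
  have keys_drop: "keys (drop \<beta>) = keys \<beta> - {Suc n}" for \<beta>
    by (simp add: drop_def keys_update)
  have eval_drop: "monom_eval \<beta> x = monom_eval (drop \<beta>) x * x (Suc n) ^ lookup \<beta> (Suc n)" for \<beta> and x :: "nat \<Rightarrow> 'a"
  proof -
    have "\<beta> = drop \<beta> + single (Suc n) (lookup \<beta> (Suc n))"
      by (rule poly_mapping_eqI) (simp add: drop_def lookup_add lookup_update lookup_single when_def)
    then show ?thesis by (metis monom_eval_add monom_eval_single)
  qed
  have inj: "inj_on drop (slice j)" for j
  proof (rule inj_onI)
    fix \<beta> \<gamma> assume *: "\<beta> \<in> slice j" "\<gamma> \<in> slice j" "drop \<beta> = drop \<gamma>"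
    show "\<beta> = \<gamma>"
    proof (rule poly_mapping_eqI)
      fix k show "lookup \<beta> k = lookup \<gamma> k"
        using *(1,2) arg_cong[OF *(3), of "\<lambda>\<delta>. lookup \<delta> k"]
        by (cases "k = Suc n") (auto simp: slice_def drop_def lookup_update)
    qed
  qed
  have fin: "finite (slice j)" for j using Suc.prems(1) by (simp add: slice_def)
  have le_N: "lookup \<beta> (Suc n) \<le> N" if "\<beta> \<in> S" for \<beta>
    using that Suc.prems(1) by (simp add: N_def)
  have slice_sum: "(\<Sum>\<beta>\<in>slice j. c \<beta> * monom_eval (drop \<beta>) x) = 0" for j and x :: "nat \<Rightarrow> 'a"
  proof -
    define q where "q = (\<Sum>j\<le>N. Polynomial.monom (\<Sum>\<beta>\<in>slice j. c \<beta> * monom_eval (drop \<beta>) x) j)"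
    have "poly q t = 0" for t
    proof -
      have indep: "monom_eval (drop \<beta>) (x(Suc n := t)) = monom_eval (drop \<beta>) x" for \<beta>
        unfolding monom_eval_def by (rule prod.cong) (auto simp: keys_drop)
      have "0 = (\<Sum>\<beta>\<in>S. c \<beta> * monom_eval \<beta> (x(Suc n := t)))"
        using Suc.prems(3) by simp
      also have "\<dots> = (\<Sum>j\<le>N. \<Sum>\<beta>\<in>slice j. c \<beta> * monom_eval \<beta> (x(Suc n := t)))"
        unfolding slice_def using Suc.prems(1) le_N
        by (intro sum.group[symmetric]) auto
      also have "\<dots> = (\<Sum>j\<le>N. \<Sum>\<beta>\<in>slice j. c \<beta> * monom_eval (drop \<beta>) x * t ^ j)"
      proof (intro sum.cong refl)
        fix j \<beta> assume "\<beta> \<in> slice j"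
        then show "c \<beta> * monom_eval \<beta> (x(Suc n := t)) = c \<beta> * monom_eval (drop \<beta>) x * t ^ j"
          by (subst eval_drop) (simp add: indep slice_def)
      qed
      also have "\<dots> = poly q t"
        by (simp add: q_def poly_sum poly_monom sum_distrib_right)
      finally show ?thesis ..
    qed
    then have "q = 0" using poly_all_0_iff_0 by blast
    then have "coeff q j = 0" by simp
    moreover have "coeff q j = (if j \<le> N then \<Sum>\<beta>\<in>slice j. c \<beta> * monom_eval (drop \<beta>) x else 0)"
      by (simp add: q_def coeff_sum)
    moreover have "slice j = {}" if "\<not> j \<le> N" using that le_N by (auto simp: slice_def)
    ultimately show ?thesis by (auto split: if_splits)
  qed
  define j where "j = lookup \<alpha> (Suc n)"
  have \<alpha>: "\<alpha> \<in> slice j" using Suc.prems(4) by (simp add: slice_def j_def)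
  have "c (the_inv_into (slice j) drop (drop \<alpha>)) = 0"
  proof (rule Suc.IH[where S = "drop ` slice j" and \<alpha> = "drop \<alpha>"
        and c = "\<lambda>\<beta>. c (the_inv_into (slice j) drop \<beta>)"])
    show "keys \<beta> \<subseteq> {1..n}" if \<beta>: "\<beta> \<in> drop ` slice j" for \<beta>
    proof -
      obtain \<gamma> where "\<gamma> \<in> S" "\<beta> = drop \<gamma>" using \<beta> by (auto simp: slice_def)
      then have "keys \<beta> \<subseteq> {1..Suc n} - {Suc n}" using Suc.prems(2)[of \<gamma>] keys_drop by blast
      then show ?thesis by (simp add: atLeastAtMostSuc_conv)
    qed
    show "(\<Sum>\<beta>\<in>drop ` slice j. c (the_inv_into (slice j) drop \<beta>) * monom_eval \<beta> x) = 0" for x :: "nat \<Rightarrow> 'a"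
      using slice_sum[where j = j and x = x] by (simp add: sum.reindex inj the_inv_into_f_f)
  qed (use fin \<alpha> in auto)
  then show ?case using \<alpha> by (simp add: the_inv_into_f_f inj)
qed

text \<open>
  Transfers identities between functions to identities between polynomials, so that invariance,
  translations and the final identity can be handled through values.
\<close>

theorem poly_eqI_eval:
  fixes p q :: "'a::field_char_0 mpol"
  assumes "p \<in> poly_ring n" "q \<in> poly_ring n" "\<And>x. poly_eval p x = poly_eval q x"
  shows "p = q"
proof (rule poly_mapping_eqI)
  fix \<alpha>
  let ?S = "keys p \<union> keys q"
  have "(\<Sum>\<alpha>\<in>?S. (lookup p \<alpha> - lookup q \<alpha>) * monom_eval \<alpha> x) = 0" for x
    using assms(3)[of x]
    by (simp add: left_diff_distrib sum_subtractf flip: poly_eval_superset[of ?S])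
  then have "lookup p \<alpha> - lookup q \<alpha> = 0" if "\<alpha> \<in> ?S"
    using assms(1,2) that
    by (intro monomials_independent[where S = ?S and n = n and c = "\<lambda>\<alpha>. lookup p \<alpha> - lookup q \<alpha>"])
      (auto simp: poly_ring_def)
  then show "lookup p \<alpha> = lookup q \<alpha>"
    by (cases "\<alpha> \<in> ?S") (auto simp: in_keys_iff)
qed

section \<open>Polynomials of bounded degree\<close>

definition polys_le :: "nat \<Rightarrow> nat \<Rightarrow> 'a::zero mpol set" where
  "polys_le n d = {p \<in> poly_ring n. \<forall>\<alpha>\<in>keys p. mdeg \<alpha> \<le> d}"

lemma total_degree_le_iff: "total_degree p \<le> d \<longleftrightarrow> (\<forall>\<alpha>\<in>keys p. mdeg \<alpha> \<le> d)"
  unfolding total_degree_def mdeg_def by (subst Max_le_iff) auto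

lemma polys_le_iff: "p \<in> polys_le n d \<longleftrightarrow> p \<in> poly_ring n \<and> total_degree p \<le> d"
  by (auto simp: polys_le_def total_degree_le_iff)

lemma polys_le_ring: "p \<in> polys_le n d \<Longrightarrow> p \<in> poly_ring n"
  by (simp add: polys_le_def)

lemma polys_le_mono: "p \<in> polys_le n d \<Longrightarrow> d \<le> e \<Longrightarrow> p \<in> polys_le n e"
  by (force simp: polys_le_def)

lemma polys_le_zero [simp]: "0 \<in> polys_le n d"
  by (simp add: polys_le_def poly_ring_def)

lemma polys_le_single:
  "keys \<alpha> \<subseteq> {1..n} \<Longrightarrow> mdeg \<alpha> \<le> d \<Longrightarrow> single \<alpha> c \<in> polys_le n d"
  by (simp add: polys_le_def poly_ring_def)

lemma polys_le_const [simp]: "const c \<in> polys_le n d"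
  by (simp add: const_def polys_le_single)

lemma polys_le_add:
  "p \<in> polys_le n d \<Longrightarrow> q \<in> polys_le n d \<Longrightarrow> p + q \<in> polys_le n d"
  unfolding polys_le_def poly_ring_def using keys_add[of p q] by blast

lemma polys_le_diff:
  fixes p q :: "'a::ab_group_add mpol"
  shows "p \<in> polys_le n d \<Longrightarrow> q \<in> polys_le n d \<Longrightarrow> p - q \<in> polys_le n d"
proof -
  have "keys (p - q) \<subseteq> keys p \<union> keys q" by (auto simp: in_keys_iff lookup_minus)
  then show "p \<in> polys_le n d \<Longrightarrow> q \<in> polys_le n d \<Longrightarrow> p - q \<in> polys_le n d"
    unfolding polys_le_def poly_ring_def by blast
qed

lemma polys_le_sum: "(\<And>i. i \<in> A \<Longrightarrow> f i \<in> polys_le n d) \<Longrightarrow> sum f A \<in> polys_le n d"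
  by (induction A rule: infinite_finite_induct) (auto intro: polys_le_add)

lemma polys_le_mult:
  fixes p q :: "'a::comm_semiring_1 mpol"
  assumes "p \<in> polys_le n d" "q \<in> polys_le n e"
  shows "p * q \<in> polys_le n (d + e)"
proof -
  have "keys \<gamma> \<subseteq> {1..n} \<and> mdeg \<gamma> \<le> d + e" if \<gamma>: "\<gamma> \<in> keys (p * q)" for \<gamma>
  proof -
    obtain \<alpha> \<beta> where "\<gamma> = \<alpha> + \<beta>" "\<alpha> \<in> keys p" "\<beta> \<in> keys q"
      using \<gamma> keys_mult[of p q] by blast
    with assms show ?thesis
      by (auto simp: polys_le_def poly_ring_def keys_add_exponent mdeg_add intro: add_mono)
  qed
  then show ?thesis by (auto simp: polys_le_def poly_ring_def)
qed

lemma polys_le_prod: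
  assumes "\<And>i. i \<in> A \<Longrightarrow> f i \<in> polys_le n 1"
  shows "prod f A \<in> (polys_le n (card A) :: 'a::comm_semiring_1 mpol set)"
  using assms
proof (induction A rule: infinite_finite_induct)
  case (insert a A)
  then have "f a * prod f A \<in> polys_le n (1 + card A)" by (intro polys_le_mult) auto
  with insert show ?case by simp
qed (auto simp flip: single_one intro!: polys_le_single)

lemma polys_le_power:
  "p \<in> polys_le n 1 \<Longrightarrow> p ^ k \<in> (polys_le n k :: 'a::comm_semiring_1 mpol set)"
  using polys_le_prod[of "{..<k}" "\<lambda>_. p" n] by simp

section \<open>Invariance in terms of values\<close>

lemma lookup_map_key:
  "\<pi> permutes S \<Longrightarrow> lookup (Poly_Mapping.map_key \<pi> \<alpha>) i = lookup \<alpha> (\<pi> i)"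
  by (simp add: map_key.rep_eq permutes_inj)

lemma bij_betw_keys_map_key:
  assumes "\<pi> permutes S"
  shows "bij_betw \<pi> (keys (Poly_Mapping.map_key \<pi> \<alpha>)) (keys \<alpha>)"
proof (rule bij_betwI')
  show "\<exists>x\<in>keys (Poly_Mapping.map_key \<pi> \<alpha>). y = \<pi> x" if "y \<in> keys \<alpha>" for y
    using that surjD[OF permutes_surj[OF assms], of y] by (auto simp: in_keys_iff lookup_map_key[OF assms])
qed (auto simp: in_keys_iff lookup_map_key[OF assms] dest: injD[OF permutes_inj[OF assms]])

lemma bij_map_key:
  assumes "\<pi> permutes S"
  shows "bij (Poly_Mapping.map_key \<pi> :: (nat \<Rightarrow>\<^sub>0 nat) \<Rightarrow> _)"
proof (rule o_bij)
  have inv: "inv \<pi> permutes S" using assms by (rule permutes_inv)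
  show "Poly_Mapping.map_key (inv \<pi>) \<circ> Poly_Mapping.map_key \<pi> = (id :: (nat \<Rightarrow>\<^sub>0 nat) \<Rightarrow> _)"
    by (auto intro!: poly_mapping_eqI simp: lookup_map_key[OF inv] lookup_map_key[OF assms]
        permutes_inverses[OF assms])
  show "Poly_Mapping.map_key \<pi> \<circ> Poly_Mapping.map_key (inv \<pi>) = (id :: (nat \<Rightarrow>\<^sub>0 nat) \<Rightarrow> _)"
    by (auto intro!: poly_mapping_eqI simp: lookup_map_key[OF inv] lookup_map_key[OF assms]
        permutes_inverses[OF assms])
qed

lemma keys_permute_vars:
  assumes "\<pi> permutes S"
  shows "keys (permute_vars \<pi> p) = {\<alpha>. Poly_Mapping.map_key \<pi> \<alpha> \<in> keys p}"
  by (auto simp: in_keys_iff lookup_permute_vars(1)[OF assms])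

lemma poly_eval_permute_vars:
  assumes "\<pi> permutes S"
  shows "poly_eval (permute_vars \<pi> p) x = poly_eval p (x \<circ> \<pi>)"
proof -
  have monom: "monom_eval (Poly_Mapping.map_key \<pi> \<alpha>) (x \<circ> \<pi>) = monom_eval \<alpha> x" for \<alpha>
    unfolding monom_eval_def
    using prod.reindex_bij_betw[OF bij_betw_keys_map_key[OF assms, of \<alpha>], of "\<lambda>i. x i ^ lookup \<alpha> i"]
    by (simp add: lookup_map_key[OF assms])
  have "bij_betw (Poly_Mapping.map_key \<pi>) (keys (permute_vars \<pi> p)) (keys p)"
  proof (rule bij_betwI')
    show "\<exists>\<alpha>\<in>keys (permute_vars \<pi> p). \<beta> = Poly_Mapping.map_key \<pi> \<alpha>" if "\<beta> \<in> keys p" for \<beta>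
      using that surjD[OF bij_is_surj[OF bij_map_key[OF assms]], of \<beta>]
      by (auto simp: keys_permute_vars[OF assms])
  qed (auto simp: keys_permute_vars[OF assms] dest: injD[OF bij_is_inj[OF bij_map_key[OF assms]]])
  from sum.reindex_bij_betw[OF this, of "\<lambda>\<alpha>. lookup p \<alpha> * monom_eval \<alpha> (x \<circ> \<pi>)"]
  show ?thesis
    by (simp add: poly_eval_monom_eval lookup_permute_vars(1)[OF assms] monom)
qed

lemma poly_ring_permute_vars:
  assumes "\<pi> permutes {1..n}" "p \<in> poly_ring n"
  shows "permute_vars \<pi> p \<in> poly_ring n"
proof -
  have "keys \<alpha> \<subseteq> {1..n}" if "Poly_Mapping.map_key \<pi> \<alpha> \<in> keys p" for \<alpha>
  proof -
    have "keys (Poly_Mapping.map_key \<pi> \<alpha>) \<subseteq> {1..n}" using assms(2) that by (auto simp: poly_ring_def)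
    then have "\<pi> ` keys (Poly_Mapping.map_key \<pi> \<alpha>) \<subseteq> {1..n}"
      using permutes_image[OF assms(1)] by blast
    then show ?thesis using bij_betw_keys_map_key[OF assms(1), of \<alpha>] by (simp add: bij_betw_def)
  qed
  then show ?thesis by (auto simp: poly_ring_def keys_permute_vars[OF assms(1)])
qed

text \<open>
  In this form closure of the invariants under ring operations is immediate from the evaluation
  rules.
\<close>

lemma invariants_iff_eval:
  fixes p :: "'a::field_char_0 mpol"
  shows "p \<in> invariants n \<longleftrightarrow>
    p \<in> poly_ring n \<and> (\<forall>\<pi>\<in>parity_perms n. \<forall>x. poly_eval p (x \<circ> \<pi>) = poly_eval p x)"
proof (intro iffI conjI ballI allI)
  assume p: "p \<in> invariants n"
  then show "p \<in> poly_ring n" by (simp add: invariants_def)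
  fix \<pi> x assume "\<pi> \<in> parity_perms n"
  then show "poly_eval p (x \<circ> \<pi>) = poly_eval p x"
    using p poly_eval_permute_vars[of \<pi> "{1..n}" p x] by (auto simp: invariants_def parity_perms_def)
next
  assume *: "p \<in> poly_ring n \<and> (\<forall>\<pi>\<in>parity_perms n. \<forall>x. poly_eval p (x \<circ> \<pi>) = poly_eval p x)"
  have "permute_vars \<pi> p = p" if "\<pi> \<in> parity_perms n" for \<pi>
  proof (rule poly_eqI_eval[of _ n])
    have \<pi>: "\<pi> permutes {1..n}" using that by (simp add: parity_perms_def)
    show "permute_vars \<pi> p \<in> poly_ring n" using \<pi> * by (simp add: poly_ring_permute_vars)
    show "poly_eval (permute_vars \<pi> p) x = poly_eval p x" for x
      using * that by (simp add: poly_eval_permute_vars[OF \<pi>])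
  qed (use * in auto)
  then show "p \<in> invariants n" using * by (simp add: invariants_def)
qed

section \<open>Translation of all variables\<close>

definition var :: "nat \<Rightarrow> 'a::{zero,one} mpol" where
  "var i = single (single i 1) 1"

lemma poly_eval_var [simp]: "poly_eval (var i) x = x i"
  by (simp add: var_def)

lemma polys_le_var: "i \<in> {1..n} \<Longrightarrow> var i \<in> polys_le n 1"
  unfolding var_def by (intro polys_le_single) auto

lemma translate_exists:
  fixes p :: "'a::comm_semiring_1 mpol"
  assumes "p \<in> polys_le n d"
  shows "\<exists>q\<in>polys_le n d. \<forall>x. poly_eval q x = poly_eval p (\<lambda>i. x i + c)"
proof (intro bexI allI)
  define q where
    "q = (\<Sum>\<alpha>\<in>keys p. const (lookup p \<alpha>) * (\<Prod>i\<in>keys \<alpha>. (var i + const c) ^ lookup \<alpha> i))"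
  have *: "(\<Prod>i\<in>V. (var i + const c) ^ lookup \<alpha> i) \<in> (polys_le n (\<Sum>i\<in>V. lookup \<alpha> i) :: 'a mpol set)"
    if "finite V" "V \<subseteq> {1..n}" for \<alpha> V
    using that
  proof (induction V)
    case empty
    show ?case by (auto simp flip: single_one intro!: polys_le_single)
  next
    case (insert i V)
    then have "(var i + const c) ^ lookup \<alpha> i \<in> (polys_le n (lookup \<alpha> i) :: 'a mpol set)"
      by (intro polys_le_power polys_le_add polys_le_var) auto
    with insert show ?case by (simp add: polys_le_mult)
  qed
  have "(\<Prod>i\<in>keys \<alpha>. (var i + const c) ^ lookup \<alpha> i) \<in> (polys_le n d :: 'a mpol set)"
    if "\<alpha> \<in> keys p" for \<alpha>
  proof (rule polys_le_mono)
    have "keys \<alpha> \<subseteq> {1..n}" "mdeg \<alpha> \<le> d" using that assms by (auto simp: polys_le_def poly_ring_def)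
    then show "(\<Prod>i\<in>keys \<alpha>. (var i + const c) ^ lookup \<alpha> i) \<in> (polys_le n (mdeg \<alpha>) :: 'a mpol set)"
      "mdeg \<alpha> \<le> d"
      unfolding mdeg_def using * by auto
  qed
  then have "const (lookup p \<alpha>) * (\<Prod>i\<in>keys \<alpha>. (var i + const c) ^ lookup \<alpha> i) \<in> polys_le n d"
    if "\<alpha> \<in> keys p" for \<alpha>
    using that polys_le_mult[OF polys_le_const[of "lookup p \<alpha>" n 0]] by force
  then show "q \<in> polys_le n d" unfolding q_def by (rule polys_le_sum)
  show "poly_eval q x = poly_eval p (\<lambda>i. x i + c)" for x
    by (simp add: q_def poly_eval_monom_eval[of p] monom_eval_def)
qed

section \<open>The vanishing theorem and uniqueness\<close>

lemma odd_size_Suc: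
  "odd_size (Suc n) l = odd_size n l + (if odd (Suc n) then l (Suc n) else 0)"
proof -
  have "{i. i \<in> {1..Suc n} \<and> odd i} =
      (if odd (Suc n) then insert (Suc n) {i. i \<in> {1..n} \<and> odd i} else {i. i \<in> {1..n} \<and> odd i})"
    by (auto simp: le_Suc_eq)
  then show ?thesis by (simp add: odd_size_def)
qed

text \<open>
  The degree of \<open>\<Prod>\<^bsub>i \<equiv> n\<^esub> z\<^sub>i\<close> is the size \<open>|(1\<^sup>n)|\<^sub>o\<^sub>d\<^sub>d\<close> whichever parity \<open>n\<close> has. This match
  is what makes the degree count in the vanishing theorem work.
\<close>

lemma card_same_parity:
  "card {i \<in> {1..n}. i mod 2 = n mod 2} = odd_size n (\<lambda>_. 1)"
proof (induction n rule: less_induct)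
  case (less n)
  show ?case
  proof (cases "n \<le> 1")
    case True
    then consider "n = 0" | "n = 1" by linarith
    then show ?thesis
    proof cases
      case 2
      then have "{i \<in> {1..n}. i mod 2 = n mod 2} = {1}" "{i \<in> {1..n}. odd i} = {1}" by auto
      then show ?thesis by (simp add: odd_size_def)
    qed (simp add: odd_size_def)
  next
    case False
    then obtain k where n: "n = Suc (Suc k)" by (cases n; cases "n - 1") auto
    have "{i \<in> {1..n}. i mod 2 = n mod 2} = insert n {i \<in> {1..k}. i mod 2 = k mod 2}"
      unfolding n by (auto simp: le_Suc_eq) presburger+
    then show ?thesis using less.IH[of k] n by (auto simp: odd_size_Suc)
  qed
qed

lemma no_zero_of_not_negative_rational:
  fixes r :: "'a::field_char_0"
  assumes "\<forall>q::rat. q < 0 \<longrightarrow> r \<noteq> of_rat q" and "0 < k"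
  shows "of_nat j * r + of_nat k \<noteq> 0"
proof
  assume *: "of_nat j * r + of_nat k = 0"
  with \<open>0 < k\<close> have j: "j \<noteq> 0" by (cases j) auto
  then have "r = of_rat (- (of_nat k / of_nat j))"
    using * by (simp add: of_rat_minus of_rat_divide field_simps eq_neg_iff_add_eq_0)
  moreover have "- (of_nat k / of_nat j) < (0::rat)" using \<open>0 < k\<close> j by simp
  ultimately show False using assms(1) by blast
qed

text \<open>
  Induction on \<open>n\<close> and on the degree bound \<open>d\<close>. After a translation let \<open>c = 0\<close>. The points with
  \<open>\<mu>\<^sub>n = 0\<close> lie on \<open>z\<^sub>n = 0\<close>, and there the restriction of \<open>p\<close> satisfies the same hypotheses in
  \<open>n - 1\<close> variables, shifted by \<open>r\<close>; hence \<open>z\<^sub>n\<close> divides \<open>p\<close>, and by invariance so does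
  \<open>\<Prod>\<^bsub>i \<equiv> n\<^esub> z\<^sub>i\<close>. The points with \<open>\<mu>\<^sub>n \<ge> 1\<close> are those with \<open>\<mu> = \<nu> + (1\<^sup>n)\<close>. The product is nonzero
  there because \<open>r\<close> is not a negative rational, so the quotient vanishes at them, which is the same
  problem shifted by \<open>1\<close> with \<open>d\<close> lowered by exactly the degree of the product. The constant \<open>c\<close>
  records these two shifts.
\<close>

theorem vanishing_imp_zero:
  fixes r :: "'a::field_char_0"
  assumes r: "\<forall>q::rat. q < 0 \<longrightarrow> r \<noteq> of_rat q"
    and "p \<in> invariants n" "total_degree p \<le> d"
    and "\<And>\<mu>. \<mu> \<in> Lambda n \<Longrightarrow> odd_size n \<mu> \<le> d \<Longrightarrow>
      poly_eval p (\<lambda>i. rho n r i + of_nat (\<mu> i) + c) = 0"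
  shows "p = 0"
  using assms(2-)
proof (induction n arbitrary: p d c)
  case 0
  have "(\<lambda>_. 0) \<in> Lambda 0" by (simp add: Lambda_def)
  then have "poly_eval p (\<lambda>i. rho 0 r i + c) = 0"
    using 0(3)[of "\<lambda>_. 0"] by (simp add: odd_size_def)
  moreover have ring: "p \<in> poly_ring 0" using 0(1) by (simp add: invariants_def)
  then have "poly_eval p x = poly_eval p (\<lambda>i. rho 0 r i + c)" for x
    by (rule poly_eval_cong) simp
  ultimately show "p = 0" using ring by (intro poly_eqI_eval[of p 0]) (auto simp: poly_ring_def)
next
  case (Suc m)
  define n where "n = Suc m"
  have "p = 0"
    if "p \<in> invariants n" "total_degree p \<le> d"
      and "\<And>\<mu>. \<mu> \<in> Lambda n \<Longrightarrow> odd_size n \<mu> \<le> d \<Longrightarrow>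
        poly_eval p (\<lambda>i. rho n r i + of_nat (\<mu> i) + c) = 0" for p d c
    using that
  proof (induction d arbitrary: p c rule: less_induct)
    case (less d)
    obtain q where q: "q \<in> polys_le n d" and eval_q: "poly_eval q x = poly_eval p (\<lambda>i. x i + c)" for x
      using translate_exists[of p n d c] less.prems(1,2) by (auto simp: polys_le_iff invariants_def)
    have q_inv: "q \<in> invariants n"
      unfolding invariants_iff_eval
    proof (intro conjI ballI allI)
      show "q \<in> poly_ring n" using q by (rule polys_le_ring)
      fix \<pi> and x :: "nat \<Rightarrow> 'a" assume "\<pi> \<in> parity_perms n"
      then have "poly_eval p ((\<lambda>i. x i + c) \<circ> \<pi>) = poly_eval p (\<lambda>i. x i + c)"
        using less.prems(1) invariants_iff_eval by blast
      then show "poly_eval q (x \<circ> \<pi>) = poly_eval q x" by (simp add: eval_q o_def)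
    qed
    have q_vanish: "poly_eval q (\<lambda>i. rho n r i + of_nat (\<mu> i)) = 0"
      if "\<mu> \<in> Lambda n" "odd_size n \<mu> \<le> d" for \<mu>
      using less.prems(3)[OF that] by (simp add: eval_q)
    \<comment> \<open>The restriction of \<open>q\<close> to \<open>z\<^sub>n = 0\<close>: the terms without \<open>z\<^sub>n\<close>.\<close>
    define q0 where "q0 = (\<Sum>\<alpha>\<in>{\<alpha>\<in>keys q. lookup \<alpha> n = 0}. single \<alpha> (lookup q \<alpha>))"
    have lookup_q0: "lookup q0 \<alpha> = (if lookup \<alpha> n = 0 then lookup q \<alpha> else 0)" for \<alpha>
      by (simp add: q0_def lookup_sum lookup_single when_def in_keys_iff)
    then have keys_q0: "keys q0 = {\<alpha>\<in>keys q. lookup \<alpha> n = 0}"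
      by (auto simp: in_keys_iff split: if_splits)
    have eval_q0: "poly_eval q0 x = poly_eval q (x(n := 0))" for x
    proof -
      have *: "monom_eval \<alpha> (x(n := 0)) = (if lookup \<alpha> n = 0 then monom_eval \<alpha> x else 0)" for \<alpha>
      proof (cases "lookup \<alpha> n = 0")
        case True
        then show ?thesis by (auto simp: monom_eval_def in_keys_iff intro!: prod.cong)
      next
        case False
        then show ?thesis by (auto simp: monom_eval_def in_keys_iff intro!: prod_zero bexI[of _ n])
      qed
      have "poly_eval q (x(n := 0)) =
          (\<Sum>\<alpha>\<in>keys q. if lookup \<alpha> n = 0 then lookup q \<alpha> * monom_eval \<alpha> x else 0)"
        unfolding poly_eval_monom_eval * by (intro sum.cong) auto
      also have "\<dots> = poly_eval q0 x"
        by (simp add: poly_eval_monom_eval keys_q0 lookup_q0 sum.inter_filter)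
      finally show ?thesis ..
    qed
    have "q0 = 0"
    proof (rule Suc.IH)
      have ring: "keys \<alpha> \<subseteq> {1..m}" if "\<alpha> \<in> keys q0" for \<alpha>
      proof -
        have "keys \<alpha> \<subseteq> {1..n}" "n \<notin> keys \<alpha>"
          using that q by (auto simp: keys_q0 polys_le_def poly_ring_def in_keys_iff)
        then show ?thesis by (auto simp: n_def le_Suc_eq)
      qed
      show "total_degree q0 \<le> d"
        using q by (auto simp: total_degree_le_iff keys_q0 polys_le_def)
      show "q0 \<in> invariants m"
        unfolding invariants_iff_eval
      proof (intro conjI ballI allI)
        show "q0 \<in> poly_ring m" using ring by (simp add: poly_ring_def)
        fix \<pi> and x :: "nat \<Rightarrow> 'a" assume \<pi>: "\<pi> \<in> parity_perms m"
        then have m: "\<pi> permutes {1..m}" by (simp add: parity_perms_def)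
        then have "\<pi> permutes {1..n}" by (rule permutes_subset) (simp add: n_def)
        moreover have fix_n: "\<pi> n = n" using m by (simp add: permutes_def n_def)
        ultimately have "\<pi> \<in> parity_perms n"
          using \<pi> by (auto simp: parity_perms_def n_def le_Suc_eq)
        moreover have "\<pi> j = n \<longleftrightarrow> j = n" for j
          using fix_n injD[OF permutes_inj[OF m], of j n] by auto
        then have "(x \<circ> \<pi>)(n := 0) = (x(n := 0)) \<circ> \<pi>"
          by (simp add: fun_eq_iff)
        ultimately show "poly_eval q0 (x \<circ> \<pi>) = poly_eval q0 x"
          using q_inv by (simp add: eval_q0 invariants_iff_eval)
      qed
      fix \<mu> assume \<mu>: "\<mu> \<in> Lambda m" "odd_size m \<mu> \<le> d"
      then have 0: "\<mu> n = 0" by (simp add: Lambda_def n_def)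
      then have "\<mu> \<in> Lambda n" using \<mu>(1) by (force simp: Lambda_def n_def less_Suc_eq)
      moreover have "odd_size n \<mu> \<le> d" using \<mu>(2) 0 by (simp add: n_def odd_size_Suc)
      ultimately have "poly_eval q (\<lambda>i. rho n r i + of_nat (\<mu> i)) = 0" by (rule q_vanish)
      moreover have "poly_eval q (\<lambda>i. rho n r i + of_nat (\<mu> i)) =
          poly_eval q ((\<lambda>i. rho m r i + of_nat (\<mu> i) + r)(n := 0))"
        using 0 by (intro poly_eval_cong[OF polys_le_ring[OF q]])
          (auto simp: rho_def n_def le_Suc_eq Suc_diff_le algebra_simps)
      ultimately show "poly_eval q0 (\<lambda>i. rho m r i + of_nat (\<mu> i) + r) = 0"
        by (simp add: eval_q0)
    qed
    then have pos_n: "0 < lookup \<alpha> n" if "\<alpha> \<in> keys q" for \<alpha>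
      using that keys_q0 by auto
    define N where "N = {i \<in> {1..n}. i mod 2 = n mod 2}"
    \<comment> \<open>The transposition of \<open>i\<close> and \<open>n\<close> lies in \<open>W\<close> and carries divisibility by \<open>z\<^sub>n\<close> to divisibility by \<open>z\<^sub>i\<close>.\<close>
    have pos: "0 < lookup \<alpha> i" if "\<alpha> \<in> keys q" "i \<in> N" for \<alpha> i
    proof -
      let ?\<pi> = "Transposition.transpose i n"
      have \<pi>: "?\<pi> permutes {1..n}" using that(2) by (intro permutes_swap_id) (auto simp: N_def n_def)
      have "?\<pi> \<in> parity_perms n"
        using \<pi> that(2) by (auto simp: parity_perms_def N_def transpose_def)
      then have "lookup q (Poly_Mapping.map_key ?\<pi> \<alpha>) = lookup q \<alpha>"
        using q_inv lookup_permute_vars(1)[OF \<pi>, of q \<alpha>] by (simp add: invariants_def)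
      then have "Poly_Mapping.map_key ?\<pi> \<alpha> \<in> keys q" using that(1) by (simp add: in_keys_iff)
      from pos_n[OF this] show ?thesis by (simp add: lookup_map_key[OF \<pi>])
    qed
    define e :: "nat \<Rightarrow>\<^sub>0 nat" where "e = (\<Sum>i\<in>N. single i 1)"
    have finN: "finite N" by (simp add: N_def)
    have lookup_e: "lookup e i = (if i \<in> N then 1 else 0)" for i
      using finN by (simp add: e_def lookup_sum lookup_single when_def)
    then have keys_e: "keys e = N" by (auto simp: in_keys_iff split: if_splits)
    have mdeg_e: "mdeg e = odd_size n (\<lambda>_. 1)"
      using card_same_parity[of n] by (simp add: mdeg_def keys_e lookup_e N_def)
    \<comment> \<open>The quotient of \<open>q\<close> by \<open>\<Prod>\<^bsub>i \<equiv> n\<^esub> z\<^sub>i\<close>, whose exponent is \<open>e\<close>.\<close>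
    define h where "h = (\<Sum>\<alpha>\<in>keys q. single (\<alpha> - e) (lookup q \<alpha>))"
    have sub: "\<alpha> - e + e = \<alpha>" if "\<alpha> \<in> keys q" for \<alpha>
    proof (rule poly_mapping_eqI)
      fix i show "lookup (\<alpha> - e + e) i = lookup \<alpha> i"
        using pos[OF that, of i] by (auto simp: lookup_add lookup_minus lookup_e)
    qed
    have q_eq: "q = single e 1 * h"
    proof -
      have "single e 1 * h = (\<Sum>\<alpha>\<in>keys q. single (\<alpha> - e + e) (lookup q \<alpha>))"
        by (simp add: h_def sum_distrib_left mult_single add.commute)
      also have "\<dots> = (\<Sum>\<alpha>\<in>keys q. single \<alpha> (lookup q \<alpha>))"
        by (rule sum.cong) (simp_all add: sub)
      finally show ?thesis using poly_mapping_sum_single[of q] by simp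
    qed
    have lookup_h: "lookup h \<alpha> = lookup q (\<alpha> + e)" for \<alpha>
    proof -
      have "\<beta> - e = \<alpha> \<longleftrightarrow> \<beta> = \<alpha> + e" if "\<beta> \<in> keys q" for \<beta>
        using sub[OF that] by auto
      then have "lookup h \<alpha> = (\<Sum>\<beta>\<in>keys q. if \<beta> = \<alpha> + e then lookup q \<beta> else 0)"
        unfolding h_def lookup_sum lookup_single when_def by (intro sum.cong) auto
      then show ?thesis by (simp add: in_keys_iff)
    qed
    have keys_h: "\<alpha> + e \<in> keys q" if "\<alpha> \<in> keys h" for \<alpha>
      using that by (simp add: in_keys_iff lookup_h)
    have "h = 0"
    proof (rule ccontr)
      assume "h \<noteq> 0"
      then obtain \<alpha> where "\<alpha> \<in> keys h" by (metis in_keys_iff lookup_zero poly_mapping_eqI)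
      then have "mdeg (\<alpha> + e) \<le> d" using keys_h q by (auto simp: polys_le_def)
      then have e_le: "mdeg e \<le> d" by (simp add: mdeg_add)
      have "n \<in> N" by (simp add: N_def n_def)
      then have e_pos: "0 < mdeg e" using finN by (auto simp: mdeg_def keys_e lookup_e card_gt_0_iff)
      have "h = 0"
      proof (rule less.IH)
        show "d - mdeg e < d" using e_le e_pos by simp
        show "total_degree h \<le> d - mdeg e"
        proof -
          have "mdeg \<alpha> \<le> d - mdeg e" if "\<alpha> \<in> keys h" for \<alpha>
            using keys_h[OF that] q mdeg_add[of \<alpha> e] by (force simp: polys_le_def)
          then show ?thesis by (simp add: total_degree_le_iff)
        qed
        show "h \<in> invariants n"
          unfolding invariants_def
        proof (intro CollectI conjI ballI)
          show "h \<in> poly_ring n"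
            using keys_h q by (fastforce simp: poly_ring_def polys_le_def keys_add_exponent)
          fix \<pi> assume \<pi>: "\<pi> \<in> parity_perms n"
          then have perm: "\<pi> permutes {1..n}" by (simp add: parity_perms_def)
          have "\<pi> i \<in> N \<longleftrightarrow> i \<in> N" for i
            using \<pi> permutes_in_image[OF perm, of i] by (auto simp: parity_perms_def N_def)
          then have e: "Poly_Mapping.map_key \<pi> \<alpha> + e = Poly_Mapping.map_key \<pi> (\<alpha> + e)" for \<alpha>
            by (intro poly_mapping_eqI) (simp add: lookup_add lookup_map_key[OF perm] lookup_e)
          have "lookup q (Poly_Mapping.map_key \<pi> \<beta>) = lookup q \<beta>" for \<beta>
            using q_inv \<pi> lookup_permute_vars(1)[OF perm, of q \<beta>] by (simp add: invariants_def)
          then show "permute_vars \<pi> h = h"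
            by (intro poly_mapping_eqI) (simp add: lookup_permute_vars(1)[OF perm] lookup_h e)
        qed
        fix \<mu> assume \<mu>: "\<mu> \<in> Lambda n" "odd_size n \<mu> \<le> d - mdeg e"
        define \<nu> where "\<nu> i = (if i \<in> {1..n} then \<mu> i + 1 else 0)" for i
        have "\<nu> \<in> Lambda n" using \<mu>(1) by (auto simp: Lambda_def \<nu>_def)
        moreover have "odd_size n \<nu> = odd_size n \<mu> + mdeg e"
          by (simp add: mdeg_e odd_size_def \<nu>_def sum_Suc)
        then have "odd_size n \<nu> \<le> d" using \<mu>(2) e_le by simp
        ultimately have "poly_eval q (\<lambda>i. rho n r i + of_nat (\<nu> i)) = 0" by (rule q_vanish)
        also have "poly_eval q (\<lambda>i. rho n r i + of_nat (\<nu> i)) =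
            poly_eval q (\<lambda>i. rho n r i + of_nat (\<mu> i) + 1)"
          by (rule poly_eval_cong[OF polys_le_ring[OF q]]) (auto simp: \<nu>_def algebra_simps)
        finally have "poly_eval q (\<lambda>i. rho n r i + of_nat (\<mu> i) + 1) = 0" .
        moreover have "monom_eval e (\<lambda>i. rho n r i + of_nat (\<mu> i) + 1) \<noteq> 0"
        proof -
          have "rho n r i + of_nat (\<mu> i) + 1 \<noteq> 0" for i
            using no_zero_of_not_negative_rational[OF r, of "\<mu> i + 1" "n - i"]
            by (simp add: rho_def add_ac)
          then show ?thesis by (simp add: monom_eval_def)
        qed
        ultimately show "poly_eval h (\<lambda>i. rho n r i + of_nat (\<mu> i) + 1) = 0"
          by (simp add: q_eq)
      qed
      with \<open>h \<noteq> 0\<close> show False ..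
    qed
    then have "poly_eval p x = 0" for x
      using eval_q[of "\<lambda>i. x i - c"] q_eq by simp
    then show "p = 0"
      using less.prems(1) by (intro poly_eqI_eval[of p n]) (auto simp: invariants_def poly_ring_def)
  qed
  then show "p = 0" using Suc.prems unfolding n_def by blast
qed

text \<open>
  Two candidates are proportional, since the combination of them that also vanishes at \<open>l\<close> is zero
  by the vanishing theorem; the normalised coefficient then fixes the factor.
\<close>

lemma is_semisym_unique:
  fixes r :: "'a::field_char_0"
  assumes r: "\<forall>q::rat. q < 0 \<longrightarrow> r \<noteq> of_rat q"
    and p: "is_semisym n r l p" and q: "is_semisym n r l q"
  shows "p = q"
proof -
  define pt :: "(nat \<Rightarrow> nat) \<Rightarrow> nat \<Rightarrow> 'a" where "pt \<mu> = (\<lambda>i. rho n r i + of_nat (\<mu> i))" for \<mu>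
  \<comment> \<open>Its value at \<open>l\<close> is zero by construction.\<close>
  define h where "h = const (poly_eval q (pt l)) * p - const (poly_eval p (pt l)) * q"
  have inv: "p \<in> invariants n" "q \<in> invariants n"
    using p q by (simp_all add: is_semisym_def)
  have le: "p \<in> polys_le n (odd_size n l)" "q \<in> polys_le n (odd_size n l)"
    using p q by (simp_all add: is_semisym_def polys_le_iff invariants_def)
  have vanish: "poly_eval p (pt \<mu>) = 0" "poly_eval q (pt \<mu>) = 0"
    if "\<mu> \<in> Lambda n" "odd_size n \<mu> \<le> odd_size n l" "\<mu> \<noteq> l" for \<mu>
    using p q that by (simp_all add: is_semisym_def pt_def)
  have "h \<in> polys_le n (0 + odd_size n l)"
    unfolding h_def by (intro polys_le_diff polys_le_mult polys_le_const le)
  then have "h \<in> polys_le n (odd_size n l)" by simp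
  have h0: "h = 0"
  proof (rule vanishing_imp_zero[OF r, where n = n and d = "odd_size n l" and c = 0])
    show "h \<in> invariants n"
      using inv \<open>h \<in> polys_le n (odd_size n l)\<close>
      by (auto simp: invariants_iff_eval h_def polys_le_iff)
    show "total_degree h \<le> odd_size n l"
      using \<open>h \<in> polys_le n (odd_size n l)\<close> by (simp add: polys_le_iff)
    show "poly_eval h (\<lambda>i. rho n r i + of_nat (\<mu> i) + 0) = 0"
      if "\<mu> \<in> Lambda n" "odd_size n \<mu> \<le> odd_size n l" for \<mu>
      using vanish[OF that] by (cases "\<mu> = l") (auto simp: h_def pt_def)
  qed
  have scalar: "lookup (const c * f) \<alpha> = c * lookup f \<alpha>" for c :: 'a and f :: "'a mpol" and \<alpha>
    by (simp add: const_def map.rep_eq when_def flip: mult_map_scale_conv_mult)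
  have proportional: "poly_eval q (pt l) * lookup p \<alpha> = poly_eval p (pt l) * lookup q \<alpha>" for \<alpha>
    using arg_cong[OF h0, of "\<lambda>h. lookup h \<alpha>"] by (simp add: h_def lookup_minus scalar)
  have eq: "poly_eval q (pt l) = poly_eval p (pt l)"
    using proportional[of "bracket_exponent n l"] p q by (simp add: is_semisym_def)
  have "poly_eval p (pt l) \<noteq> 0"
  proof
    assume "poly_eval p (pt l) = 0"
    then have "p = 0"
      using p vanish(1)
      by (intro vanishing_imp_zero[OF r, where n = n and d = "odd_size n l" and c = 0])
        (auto simp: is_semisym_def pt_def)
    then show False using p by (simp add: is_semisym_def)
  qed
  then show "p = q" using proportional eq by (intro poly_mapping_eqI) simp
qed

lemma R_eqI:
  fixes r :: "'a::field_char_0"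
  assumes "\<forall>q::rat. q < 0 \<longrightarrow> r \<noteq> of_rat q" and "l \<in> Lambda n" and "is_semisym n r l p"
  shows "R n r l = p"
  unfolding R_def using assms is_semisym_unique by (auto intro!: the_equality)

section \<open>Lexicographic leading monomials\<close>

text \<open>
  The order on exponents is the lexicographic one in which \<open>z\<^sub>1\<close> is the largest variable. For all
  polynomials considered here the normalised monomial \<open>z\<^bsup>[\<lambda>]\<^esup>\<close> is the leading one, so that
  coefficients of products need not be expanded.
\<close>

definition lex_monic :: "'a::zero_neq_one mpol \<Rightarrow> (nat \<Rightarrow>\<^sub>0 nat) \<Rightarrow> bool" where
  "lex_monic p \<alpha> \<longleftrightarrow> lookup p \<alpha> = 1 \<and> (\<forall>\<beta>\<in>keys p. \<beta> \<le> \<alpha>)"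

lemma lex_lessI:
  fixes \<alpha> \<beta> :: "nat \<Rightarrow>\<^sub>0 nat"
  assumes "lookup \<alpha> k < lookup \<beta> k" "\<And>j. j < k \<Longrightarrow> lookup \<alpha> j = lookup \<beta> j"
  shows "\<alpha> < \<beta>"
  using assms by (auto simp: less_poly_mapping.rep_eq less_fun_def)

lemma lex_monic_add:
  fixes p q :: "'a::comm_ring_1 mpol"
  assumes "lex_monic p \<alpha>" "\<And>\<beta>. \<beta> \<in> keys q \<Longrightarrow> \<beta> < \<alpha>"
  shows "lex_monic (p + q) \<alpha>"
proof -
  have "lookup q \<alpha> = 0" using assms(2) by (auto simp: in_keys_iff)
  moreover have "\<beta> \<le> \<alpha>" if "\<beta> \<in> keys (p + q)" for \<beta>
    using that keys_add[of p q] assms by (auto simp: lex_monic_def intro: less_imp_le)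
  ultimately show ?thesis using assms(1) by (simp add: lex_monic_def lookup_add)
qed

lemma lex_monic_diff:
  fixes p q :: "'a::comm_ring_1 mpol"
  assumes "lex_monic p \<alpha>" "\<And>\<beta>. \<beta> \<in> keys q \<Longrightarrow> \<beta> < \<alpha>"
  shows "lex_monic (p - q) \<alpha>"
  using lex_monic_add[of p \<alpha> "- q"] assms by (simp add: in_keys_iff)

lemma lex_monic_single: "lex_monic (single \<alpha> 1) \<alpha>"
  by (simp add: lex_monic_def)

lemma lex_monic_mult:
  fixes p q :: "'a::comm_ring_1 mpol"
  assumes "lex_monic p \<alpha>" "lex_monic q \<beta>"
  shows "lex_monic (p * q) (\<alpha> + \<beta>)"
proof -
  have lower: "\<gamma> < \<alpha>" if "lex_monic p \<alpha>" "\<gamma> \<in> keys (p - single \<alpha> 1)" for p :: "'a mpol" and \<alpha> \<gamma>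
    using that by (auto simp: lex_monic_def in_keys_iff lookup_minus lookup_single when_def
        less_le split: if_splits)
  \<comment> \<open>The part of the product without the leading term; all its exponents are smaller.\<close>
  define s where "s = single \<alpha> 1 * (q - single \<beta> 1) + (p - single \<alpha> 1) * q"
  have "p * q = single (\<alpha> + \<beta>) 1 + s"
    by (simp add: s_def algebra_simps mult_single)
  moreover have "\<gamma> < \<alpha> + \<beta>" if \<gamma>: "\<gamma> \<in> keys s" for \<gamma>
  proof -
    consider "\<gamma> \<in> keys (single \<alpha> 1 * (q - single \<beta> 1))" | "\<gamma> \<in> keys ((p - single \<alpha> 1) * q)"
      using \<gamma> keys_add[of "single \<alpha> 1 * (q - single \<beta> 1)" "(p - single \<alpha> 1) * q"] by (auto simp: s_def)
    then show ?thesis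
    proof cases
      case 1
      then obtain \<delta> where "\<gamma> = \<alpha> + \<delta>" "\<delta> \<in> keys (q - single \<beta> 1)"
        using keys_mult[of "single \<alpha> (1::'a)" "q - single \<beta> 1"] by auto
      then show ?thesis using lower[OF assms(2)] by (simp add: add_strict_left_mono)
    next
      case 2
      then obtain \<delta> \<epsilon> where "\<gamma> = \<delta> + \<epsilon>" "\<delta> \<in> keys (p - single \<alpha> 1)" "\<epsilon> \<in> keys q"
        using keys_mult[of "p - single \<alpha> 1" q] by blast
      then show ?thesis
        using lower[OF assms(1)] assms(2) by (auto simp: lex_monic_def intro: add_less_le_mono)
    qed
  qed
  ultimately show ?thesis using lex_monic_add[OF lex_monic_single, of s "\<alpha> + \<beta>"] by simp
qed

lemma lex_monic_prod:
  fixes f :: "'b \<Rightarrow> 'a::comm_ring_1 mpol"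
  assumes "finite A" "\<And>i. i \<in> A \<Longrightarrow> lex_monic (f i) (\<alpha> i)"
  shows "lex_monic (prod f A) (sum \<alpha> A)"
  using assms
proof (induction A)
  case empty
  show ?case using lex_monic_single[of 0] by simp
qed (simp add: lex_monic_mult)

lemma lex_monic_var_plus_const:
  "lex_monic (var i + const c :: 'a::comm_ring_1 mpol) (single i 1)"
proof (rule lex_monic_add)
  show "lex_monic (var i) (single i 1)" unfolding var_def by (rule lex_monic_single)
  show "\<beta> < single i 1" if "\<beta> \<in> keys (const c)" for \<beta>
    using that by (intro lex_lessI[of _ i]) (auto simp: const_def lookup_single split: if_splits)
qed

section \<open>Shifted elementary polynomials in the variables of one parity\<close>

definition parity_class :: "nat \<Rightarrow> nat \<Rightarrow> nat set" where
  "parity_class n b = {i \<in> {1..n}. i mod 2 = b}"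

definition subsets_of_card :: "'b set \<Rightarrow> nat \<Rightarrow> 'b set set" where
  "subsets_of_card A k = {I. I \<subseteq> A \<and> card I = k}"

definition later :: "nat set \<Rightarrow> nat \<Rightarrow> nat" where
  "later I i = card {u \<in> I. i < u}"

text \<open>
  The shifted elementary symmetric polynomial (a shifted Jack polynomial of a column, with
  parameter \<open>2r\<close>) in the variables \<open>z\<^sub>i\<close> with \<open>i mod 2 = b\<close>. In this form its values at
  \<open>\<rho> + \<mu>\<close> can be read off; its symmetry is hidden.
\<close>

definition shifted_elementary :: "nat \<Rightarrow> 'a::comm_ring_1 \<Rightarrow> nat \<Rightarrow> nat \<Rightarrow> 'a mpol" where
  "shifted_elementary n r b k = (\<Sum>I\<in>subsets_of_card (parity_class n b) k.
     \<Prod>i\<in>I. var i + const (of_nat (later I i) * (2 * r) - rho n r i))"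

lemma finite_parity_class [simp]: "finite (parity_class n b)"
  by (simp add: parity_class_def)

lemma finite_subsets_of_card [simp]: "finite A \<Longrightarrow> finite (subsets_of_card A k)"
  by (simp add: subsets_of_card_def)

lemma subsets_of_card_0: "finite A \<Longrightarrow> subsets_of_card A 0 = {{}}"
  by (auto simp: subsets_of_card_def dest: finite_subset)

lemma sum_subsets_of_card_insert:
  assumes "finite B" "a \<notin> B"
  shows "(\<Sum>I\<in>subsets_of_card (insert a B) (Suc k). f I) =
    (\<Sum>I\<in>subsets_of_card B (Suc k). f I) + (\<Sum>I\<in>subsets_of_card B k. f (insert a I))"
proof -
  have "subsets_of_card (insert a B) (Suc k) =
      subsets_of_card B (Suc k) \<union> insert a ` subsets_of_card B k" (is "?L = ?M \<union> ?N")
  proof (intro equalityI subsetI)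
    fix I assume I: "I \<in> ?L"
    show "I \<in> ?M \<union> ?N"
    proof (cases "a \<in> I")
      case True
      have "finite I" using I assms(1) by (auto simp: subsets_of_card_def intro: finite_subset)
      then have "I - {a} \<in> subsets_of_card B k" using I True by (auto simp: subsets_of_card_def)
      moreover have "I = insert a (I - {a})" using True by auto
      ultimately show ?thesis by blast
    qed (use I in \<open>auto simp: subsets_of_card_def\<close>)
  next
    fix I assume "I \<in> ?M \<union> ?N"
    then show "I \<in> ?L"
    proof
      assume "I \<in> ?N"
      then obtain J where "I = insert a J" "J \<subseteq> B" "card J = k" by (auto simp: subsets_of_card_def)
      moreover from this have "finite J" "a \<notin> J" using assms by (auto dest: finite_subset)
      ultimately show ?thesis by (auto simp: subsets_of_card_def)
    qed (auto simp: subsets_of_card_def)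
  qed
  moreover have "inj_on (insert a) (subsets_of_card B k)"
    using assms(2) by (intro inj_onI) (auto simp: subsets_of_card_def)
  moreover have "?M \<inter> ?N = {}" using assms(2) by (auto simp: subsets_of_card_def)
  ultimately show ?thesis using assms(1) by (simp add: sum.union_disjoint sum.reindex)
qed

definition elementary :: "nat set \<Rightarrow> nat \<Rightarrow> (nat \<Rightarrow> 'a::comm_ring_1) \<Rightarrow> 'a" where
  "elementary A k y = (\<Sum>I\<in>subsets_of_card A k. \<Prod>i\<in>I. y i)"

text \<open>
  This is \<open>(-s)\<^sup>l\<close> times the Stirling number of the second kind \<open>S(M, M - l)\<close>: the coefficient of
  \<open>t (t + s) \<cdots> (t + (M - l - 1) s)\<close> in the expansion of \<open>t\<^sup>M\<close>.
\<close>

fun shift_coeff :: "'a::comm_ring_1 \<Rightarrow> nat \<Rightarrow> nat \<Rightarrow> 'a" where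
  "shift_coeff s M 0 = 1"
| "shift_coeff s 0 (Suc l) = 0"
| "shift_coeff s (Suc M) (Suc l) =
     shift_coeff s M (Suc l) - s * (of_nat M - of_nat l) * shift_coeff s M l"

text \<open>
  This makes the symmetry of the left-hand side visible. Write it as \<open>J\<^sub>k A\<close>; the number subtracted
  at \<open>i\<close> counts the later elements that are \<^emph>\<open>not\<close> chosen. Adding a new smallest
  element \<open>b\<close> leaves the other counts unchanged, which gives the recursion
  \<open>J\<^sub>k (B \<union> {b}) = J\<^sub>k B + (y\<^sub>b - s (|B| - (k - 1))) J\<^bsub>k-1\<^esub> B\<close>; the recursion
  \<open>e\<^sub>k (B \<union> {b}) = e\<^sub>k B + y\<^sub>b e\<^bsub>k-1\<^esub> B\<close> turns it into the one that defines the coefficients.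
\<close>

lemma shifted_sum_eq_elementary:
  fixes y :: "nat \<Rightarrow> 'a::comm_ring_1"
  assumes "finite A"
  shows "(\<Sum>I\<in>subsets_of_card A k. \<Prod>i\<in>I. y i - s * of_nat (later (A - I) i)) =
    (\<Sum>j\<le>k. shift_coeff s (card A - j) (k - j) * elementary A j y)"
  using assms
proof (induction A arbitrary: k rule: finite_linorder_min_induct)
  case empty
  have sub: "subsets_of_card {} j = (if j = 0 then {{}} else {})" for j
    by (auto simp: subsets_of_card_def)
  have "shift_coeff s 0 k = (if k = 0 then 1 else 0)" by (cases k) auto
  moreover have "elementary {} j y = (if j = 0 then 1 else 0)" for j
    by (simp add: sub elementary_def)
  ultimately have "shift_coeff s (card {} - j) (k - j) * elementary {} j y =
      (if j = 0 then shift_coeff s 0 k else 0)" for j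
    by simp
  then show ?case using \<open>shift_coeff s 0 k = _\<close> by (simp add: sub)
next
  case (insert b B)
  let ?J = "\<lambda>B k. \<Sum>I\<in>subsets_of_card B k. \<Prod>i\<in>I. y i - s * of_nat (later (B - I) i)"
  have fin: "finite B" and b: "b \<notin> B" using insert.hyps by auto
  show ?case
  proof (cases k)
    case 0
    then show ?thesis using fin by (simp add: subsets_of_card_0 elementary_def)
  next
    case (Suc l)
    have rec: "?J (insert b B) (Suc l) = ?J B (Suc l) + (y b - s * (of_nat (card B) - of_nat l)) * ?J B l"
    proof -
      have same: "later (insert b B - I) i = later (B - I) i" if "i \<in> I" "I \<subseteq> B" for I i
      proof -
        have "b < i" using that insert.hyps(2) by blast
        then have "{u \<in> insert b B - I. i < u} = {u \<in> B - I. i < u}" by auto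
        then show ?thesis by (simp add: later_def)
      qed
      have new: "of_nat (later (B - I) b) = (of_nat (card B) - of_nat l :: 'a)"
        if "I \<in> subsets_of_card B l" for I
      proof -
        have "{u \<in> B - I. b < u} = B - I" using insert.hyps(2) by auto
        moreover have "card (B - I) = card B - l" "l \<le> card B"
          using that fin by (auto simp: subsets_of_card_def card_Diff_subset finite_subset card_mono)
        ultimately show ?thesis by (simp add: later_def)
      qed
      have "(\<Prod>i\<in>insert b I. y i - s * of_nat (later (insert b B - insert b I) i)) =
          (y b - s * (of_nat (card B) - of_nat l)) * (\<Prod>i\<in>I. y i - s * of_nat (later (B - I) i))"
        if I: "I \<in> subsets_of_card B l" for I
      proof -
        have "I \<subseteq> B" "finite I" "b \<notin> I"
          using I fin b by (auto simp: subsets_of_card_def dest: finite_subset)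
        then show ?thesis using new[OF I] b by simp
      qed
      moreover have "(\<Prod>i\<in>I. y i - s * of_nat (later (insert b B - I) i)) =
          (\<Prod>i\<in>I. y i - s * of_nat (later (B - I) i))" if "I \<in> subsets_of_card B (Suc l)" for I
        using that by (intro prod.cong) (auto simp: subsets_of_card_def same)
      ultimately show ?thesis
        by (simp add: sum_subsets_of_card_insert[OF fin b] sum_distrib_left)
    qed
    have e_rec: "elementary (insert b B) (Suc j) y = elementary B (Suc j) y + y b * elementary B j y" for j
    proof -
      have "(\<Prod>i\<in>insert b I. y i) = y b * (\<Prod>i\<in>I. y i)" if "I \<in> subsets_of_card B j" for I
      proof -
        have "finite I" "b \<notin> I" using that fin b by (auto simp: subsets_of_card_def dest: finite_subset)
        then show ?thesis by simp
      qed
      then show ?thesis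
        by (simp add: elementary_def sum_subsets_of_card_insert[OF fin b] sum_distrib_left)
    qed
    have e_0: "elementary (insert b B) 0 y = elementary B 0 y"
      using fin by (simp add: elementary_def subsets_of_card_0)
    have e_big: "elementary B j y = 0" if "card B < j" for j
    proof -
      have "card I < j" if "I \<subseteq> B" for I using card_mono[OF fin that] \<open>card B < j\<close> by simp
      then have "subsets_of_card B j = {}" by (auto simp: subsets_of_card_def)
      then show ?thesis by (simp add: elementary_def)
    qed
    have coeff: "shift_coeff s (Suc (card B) - j) (Suc l - j) * elementary B j y =
        shift_coeff s (card B - j) (Suc l - j) * elementary B j y
        - s * (of_nat (card B) - of_nat l) * (shift_coeff s (card B - j) (l - j) * elementary B j y)"
      if "j \<le> l" for j
    proof (cases "j \<le> card B")
      case True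
      then show ?thesis using that by (simp add: Suc_diff_le of_nat_diff algebra_simps)
    qed (simp add: e_big)
    have "(\<Sum>j\<le>Suc l. shift_coeff s (card (insert b B) - j) (Suc l - j) * elementary (insert b B) j y) =
        (\<Sum>j\<le>Suc l. shift_coeff s (Suc (card B) - j) (Suc l - j) * elementary B j y)
        + y b * (\<Sum>j\<le>l. shift_coeff s (card B - j) (l - j) * elementary B j y)"
      using fin b
      by (simp add: sum.atMost_Suc_shift e_0 e_rec sum.distrib distrib_left sum_distrib_left mult_ac
          del: sum.atMost_Suc shift_coeff.simps(3))
    also have "(\<Sum>j\<le>Suc l. shift_coeff s (Suc (card B) - j) (Suc l - j) * elementary B j y) =
        (\<Sum>j\<le>Suc l. shift_coeff s (card B - j) (Suc l - j) * elementary B j y)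
        - s * (of_nat (card B) - of_nat l) * (\<Sum>j\<le>l. shift_coeff s (card B - j) (l - j) * elementary B j y)"
      by (simp add: coeff sum_subtractf sum_distrib_left)
    finally show ?thesis
      by (simp add: Suc rec insert.IH algebra_simps del: sum.atMost_Suc)
  qed
qed

lemma elementary_permute:
  assumes "\<pi> permutes S" "\<pi> ` A = A"
  shows "elementary A k (y \<circ> \<pi>) = elementary A k y"
proof -
  have inj: "inj \<pi>" using assms(1) by (rule permutes_inj)
  have "bij_betw ((`) \<pi>) (subsets_of_card A k) (subsets_of_card A k)"
  proof (rule bij_betwI')
    show "(\<pi> ` I = \<pi> ` J) = (I = J)" for I J using inj by (simp add: inj_image_eq_iff)
    show "\<pi> ` I \<in> subsets_of_card A k" if "I \<in> subsets_of_card A k" for I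
      using that assms(2) by (auto simp: subsets_of_card_def card_image inj_on_subset[OF inj])
    show "\<exists>I\<in>subsets_of_card A k. J = \<pi> ` I" if J: "J \<in> subsets_of_card A k" for J
    proof -
      have "J \<subseteq> \<pi> ` A" using J assms(2) by (simp add: subsets_of_card_def)
      then obtain I where "I \<subseteq> A" "J = \<pi> ` I" by (rule subset_imageE)
      then show ?thesis using J by (auto simp: subsets_of_card_def card_image inj_on_subset[OF inj])
    qed
  qed
  from sum.reindex_bij_betw[OF this, of "\<lambda>I. \<Prod>i\<in>I. y i"]
  show ?thesis by (simp add: elementary_def prod.reindex inj_on_subset[OF inj])
qed

lemma later_parity_class:
  assumes "i \<in> parity_class n b"
  shows "later (parity_class n b) i = (n - i) div 2"
proof -
  have "{u \<in> parity_class n b. i < u} = (\<lambda>t. i + 2 * t) ` {1..(n - i) div 2}"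
  proof (intro equalityI subsetI)
    fix u assume u: "u \<in> {u \<in> parity_class n b. i < u}"
    then have "(u - i) mod 2 = 0" using assms
      by (auto simp: parity_class_def mod_eq_dvd_iff_nat[of i u] less_imp_le)
    then have "u = i + 2 * ((u - i) div 2)" using u by auto
    moreover have "(u - i) div 2 \<in> {1..(n - i) div 2}"
      using u \<open>(u - i) mod 2 = 0\<close> by (auto simp: parity_class_def div_le_mono)
    ultimately show "u \<in> (\<lambda>t. i + 2 * t) ` {1..(n - i) div 2}" by blast
  next
    fix u assume "u \<in> (\<lambda>t. i + 2 * t) ` {1..(n - i) div 2}"
    then show "u \<in> {u \<in> parity_class n b. i < u}" using assms by (auto simp: parity_class_def)
  qed
  moreover have "inj_on (\<lambda>t. i + 2 * t) {1..(n - i) div 2}" by (intro inj_onI) simp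
  ultimately show ?thesis by (simp add: later_def card_image)
qed

lemma parity_perms_image:
  assumes "\<pi> \<in> parity_perms n"
  shows "\<pi> ` parity_class n b = parity_class n b"
proof (rule card_subset_eq)
  have \<pi>: "\<pi> permutes {1..n}" using assms by (simp add: parity_perms_def)
  show "\<pi> ` parity_class n b \<subseteq> parity_class n b"
    using assms permutes_in_image[OF \<pi>] by (auto simp: parity_class_def parity_perms_def)
  show "card (\<pi> ` parity_class n b) = card (parity_class n b)"
    by (intro card_image inj_on_subset[OF permutes_inj[OF \<pi>]]) simp
qed simp

lemma shifted_elementary_polys_le: "shifted_elementary n r b k \<in> polys_le n k"
  unfolding shifted_elementary_def
proof (rule polys_le_sum)
  fix I assume "I \<in> subsets_of_card (parity_class n b) k"
  then have I: "I \<subseteq> {1..n}" "card I = k" by (auto simp: subsets_of_card_def parity_class_def)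
  have "(\<Prod>i\<in>I. var i + const (of_nat (later I i) * (2 * r) - rho n r i)) \<in> polys_le n (card I)"
    using I(1) by (intro polys_le_prod polys_le_add polys_le_var polys_le_const) auto
  then show "(\<Prod>i\<in>I. var i + const (of_nat (later I i) * (2 * r) - rho n r i)) \<in> polys_le n k"
    using I(2) by simp
qed

lemma poly_eval_shifted_elementary:
  "poly_eval (shifted_elementary n r b k) x =
    (\<Sum>I\<in>subsets_of_card (parity_class n b) k. \<Prod>i\<in>I. x i + (of_nat (later I i) * (2 * r) - rho n r i))"
  by (simp add: shifted_elementary_def)

text \<open>
  On one parity class \<open>\<rho>\<^sub>i\<close> is a constant plus \<open>2r\<close> times the number of later indices. So adding
  \<open>2r\<close> times the number of later chosen indices to \<open>z\<^sub>i - \<rho>\<^sub>i\<close> amounts to subtracting \<open>2r\<close> times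
  the number of later indices that are not chosen, and the expansion in elementary symmetric
  polynomials applies.
\<close>

lemma shifted_elementary_invariant:
  fixes r :: "'a::field_char_0"
  shows "shifted_elementary n r b k \<in> invariants n"
  unfolding invariants_iff_eval
proof (intro conjI ballI allI)
  show "shifted_elementary n r b k \<in> poly_ring n"
    using shifted_elementary_polys_le by (rule polys_le_ring)
  let ?A = "parity_class n b"
  define c where "c = of_nat ((n + b) mod 2) * r"
  have eval: "poly_eval (shifted_elementary n r b k) x =
      (\<Sum>j\<le>k. shift_coeff (2 * r) (card ?A - j) (k - j) * elementary ?A j (\<lambda>i. x i - c))" for x
  proof -
    have "x i + (of_nat (later I i) * (2 * r) - rho n r i) = x i - c - 2 * r * of_nat (later (?A - I) i)"
      if "I \<subseteq> ?A" "i \<in> I" for I i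
    proof -
      have i: "i \<in> ?A" using that by blast
      have "{u \<in> ?A. i < u} = {u \<in> I. i < u} \<union> {u \<in> ?A - I. i < u}" using that by auto
      moreover have "card ({u \<in> I. i < u} \<union> {u \<in> ?A - I. i < u}) = later I i + later (?A - I) i"
        unfolding later_def using that
        by (intro card_Un_disjoint) (auto intro: finite_subset[of _ ?A])
      ultimately have count: "later I i + later (?A - I) i = (n - i) div 2"
        using later_parity_class[OF i] by (simp add: later_def)
      have "i \<le> n" "i mod 2 = b" using i by (auto simp: parity_class_def)
      then have "n + b = (n - i) + 2 * (i - i div 2)"
        using div_mult_mod_eq[of i 2] by linarith
      then have parity: "(n + b) mod 2 = (n - i) mod 2" by simp
      have "n - i = 2 * (later I i + later (?A - I) i) + (n + b) mod 2"
        unfolding count parity by (rule mult_div_mod_eq[symmetric])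
      then have "rho n r i = of_nat (2 * (later I i + later (?A - I) i) + (n + b) mod 2) * r"
        by (simp only: rho_def)
      then show ?thesis by (simp add: c_def algebra_simps)
    qed
    then have "poly_eval (shifted_elementary n r b k) x =
        (\<Sum>I\<in>subsets_of_card ?A k. \<Prod>i\<in>I. (x i - c) - 2 * r * of_nat (later (?A - I) i))"
      unfolding poly_eval_shifted_elementary
      by (intro sum.cong prod.cong refl) (auto simp: subsets_of_card_def)
    then show ?thesis using shifted_sum_eq_elementary[where A = ?A and k = k and y = "\<lambda>i. x i - c" and s = "2 * r"] by simp
  qed
  fix \<pi> and x :: "nat \<Rightarrow> 'a" assume \<pi>: "\<pi> \<in> parity_perms n"
  have "elementary ?A j ((\<lambda>i. x i - c) \<circ> \<pi>) = elementary ?A j (\<lambda>i. x i - c)" for j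
    using \<pi> parity_perms_image[OF \<pi>] by (intro elementary_permute) (auto simp: parity_perms_def)
  then show "poly_eval (shifted_elementary n r b k) (x \<circ> \<pi>) = poly_eval (shifted_elementary n r b k) x"
    by (simp add: eval o_def)
qed

section \<open>Leading monomials of the shifted elementary polynomials\<close>

definition squarefree_exponent :: "nat set \<Rightarrow> nat \<Rightarrow>\<^sub>0 nat" where
  "squarefree_exponent I = (\<Sum>i\<in>I. single i 1)"

text \<open>
  The exponent of the product of the first \<open>k\<close> variables of parity \<open>b\<close>: those with index at most
  \<open>2k\<close>, for either parity.
\<close>

definition leading_exponent :: "nat \<Rightarrow> nat \<Rightarrow> nat \<Rightarrow>\<^sub>0 nat" where
  "leading_exponent b k = squarefree_exponent (parity_class (2 * k) b)"

lemma lookup_squarefree_exponent: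
  "finite I \<Longrightarrow> lookup (squarefree_exponent I) j = (if j \<in> I then 1 else 0)"
  by (simp add: squarefree_exponent_def lookup_sum lookup_single when_def)

lemma lookup_leading_exponent: "lookup (leading_exponent b k) j = (if j \<in> parity_class (2 * k) b then 1 else 0)"
  unfolding leading_exponent_def by (simp add: lookup_squarefree_exponent)

lemma parity_class_Suc:
  "parity_class (Suc n) b = (if Suc n mod 2 = b then insert (Suc n) (parity_class n b) else parity_class n b)"
  by (auto simp: parity_class_def le_Suc_eq)

lemma parity_class_0 [simp]: "parity_class 0 b = {}"
  by (simp add: parity_class_def)

lemma card_parity_class_even: "b < 2 \<Longrightarrow> card (parity_class (2 * k) b) = k"
proof (induction k)
  case (Suc k)
  have step: "parity_class (2 * Suc k) b =
      (if b = 0 then insert (Suc (Suc (2 * k))) (parity_class (2 * k) b)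
       else insert (Suc (2 * k)) (parity_class (2 * k) b))"
  proof -
    have "2 * Suc k = Suc (Suc (2 * k))" "Suc (2 * k) mod 2 = 1" "Suc (Suc (2 * k)) mod 2 = 0"
      by simp_all
    moreover have "b = 0 \<or> b = 1" using Suc.prems by auto
    ultimately show ?thesis by (auto simp only: parity_class_Suc) simp_all
  qed
  have "Suc (2 * k) \<notin> parity_class (2 * k) b" "Suc (Suc (2 * k)) \<notin> parity_class (2 * k) b"
    by (auto simp: parity_class_def)
  then show ?case unfolding step using Suc by (cases "b = 0") simp_all
qed simp

text \<open>
  At the smallest index of the first \<open>k\<close> that is missing from \<open>I\<close>, the two exponents differ for
  the first time.
\<close>

lemma subset_leading_exponent_le:
  assumes "b < 2" "I \<in> subsets_of_card (parity_class n b) k"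
  shows "squarefree_exponent I \<le> leading_exponent b k"
    and "I \<noteq> parity_class (2 * k) b \<Longrightarrow> squarefree_exponent I < leading_exponent b k"
proof -
  let ?L = "parity_class (2 * k) b"
  have I: "I \<subseteq> parity_class n b" "card I = k" "finite I"
    using assms(2) by (auto simp: subsets_of_card_def intro: finite_subset)
  show less: "squarefree_exponent I < leading_exponent b k" if "I \<noteq> ?L"
  proof -
    have "\<not> ?L \<subseteq> I"
      using that I card_subset_eq[of I ?L] card_parity_class_even[OF assms(1), of k] by auto
    then have "Min (?L - I) \<in> ?L - I" by (intro Min_in) auto
    moreover have "j \<in> I \<longleftrightarrow> j \<in> ?L" if "j < Min (?L - I)" for j
    proof
      assume "j \<in> ?L"
      then show "j \<in> I" using that by (metis DiffI Min_le finite_Diff finite_parity_class leD)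
    next
      assume "j \<in> I"
      then show "j \<in> ?L"
        using I(1) that \<open>Min (?L - I) \<in> ?L - I\<close> by (auto simp: parity_class_def)
    qed
    ultimately show ?thesis
      by (intro lex_lessI[of _ "Min (?L - I)"]) (auto simp: lookup_squarefree_exponent[OF I(3)] lookup_leading_exponent)
  qed
  show "squarefree_exponent I \<le> leading_exponent b k"
    using less by (cases "I = ?L") (auto simp: leading_exponent_def)
qed

lemma lex_monic_keysD: "lex_monic p \<alpha> \<Longrightarrow> \<beta> \<in> keys p \<Longrightarrow> \<beta> \<le> \<alpha>"
  by (simp add: lex_monic_def)

lemma lex_monic_prod_var_plus_const:
  assumes "finite I"
  shows "lex_monic (\<Prod>i\<in>I. var i + const (c i) :: 'a::comm_ring_1 mpol) (squarefree_exponent I)"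
  unfolding squarefree_exponent_def using assms by (intro lex_monic_prod lex_monic_var_plus_const)

lemma keys_shifted_elementary:
  assumes "\<beta> \<in> keys (shifted_elementary n r b k)"
  obtains I where "I \<in> subsets_of_card (parity_class n b) k" "\<beta> \<le> squarefree_exponent I"
proof -
  let ?t = "\<lambda>I. \<Prod>i\<in>I. var i + const (of_nat (later I i) * (2 * r) - rho n r i)"
  from assms have "\<beta> \<in> keys (\<Sum>I\<in>subsets_of_card (parity_class n b) k. ?t I)"
    by (simp only: shifted_elementary_def)
  then have "\<beta> \<in> (\<Union>I\<in>subsets_of_card (parity_class n b) k. keys (?t I))"
    by (rule subsetD[OF keys_sum])
  then obtain I where I: "I \<in> subsets_of_card (parity_class n b) k" and \<beta>: "\<beta> \<in> keys (?t I)"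
    by (rule UN_E)
  have "finite I" using I by (auto simp: subsets_of_card_def intro: finite_subset)
  from \<beta> have "\<beta> \<le> squarefree_exponent I"
    by (rule lex_monic_keysD[OF lex_monic_prod_var_plus_const[OF \<open>finite I\<close>]])
  with I show ?thesis by (rule that)
qed

lemma keys_shifted_elementary_le:
  assumes "b < 2" "\<beta> \<in> keys (shifted_elementary n r b k)"
  shows "\<beta> \<le> leading_exponent b k"
proof -
  from assms(2) obtain I where "I \<in> subsets_of_card (parity_class n b) k" "\<beta> \<le> squarefree_exponent I"
    by (rule keys_shifted_elementary)
  with subset_leading_exponent_le(1)[OF assms(1)] show ?thesis by (meson order_trans)
qed

lemma lex_monic_shifted_elementary:
  fixes r :: "'a::comm_ring_1"
  assumes "b < 2" "parity_class (2 * k) b \<subseteq> {1..n}"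
  shows "lex_monic (shifted_elementary n r b k) (leading_exponent b k)"
proof -
  let ?L = "parity_class (2 * k) b"
  let ?S = "subsets_of_card (parity_class n b) k"
  let ?t = "\<lambda>I. \<Prod>i\<in>I. var i + const (of_nat (later I i) * (2 * r) - rho n r i)"
  have L: "?L \<in> ?S"
    using assms card_parity_class_even by (auto simp: subsets_of_card_def parity_class_def)
  have "shifted_elementary n r b k = ?t ?L + (\<Sum>I\<in>?S - {?L}. ?t I)"
    unfolding shifted_elementary_def using L by (intro sum.remove) auto
  moreover have "lex_monic (?t ?L + (\<Sum>I\<in>?S - {?L}. ?t I)) (leading_exponent b k)"
  proof (rule lex_monic_add)
    show "lex_monic (?t ?L) (leading_exponent b k)"
      unfolding leading_exponent_def by (intro lex_monic_prod_var_plus_const) simp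
    fix \<beta> assume "\<beta> \<in> keys (\<Sum>I\<in>?S - {?L}. ?t I)"
    then have "\<beta> \<in> (\<Union>I\<in>?S - {?L}. keys (?t I))" by (rule subsetD[OF keys_sum])
    then obtain I where "I \<in> ?S - {?L}" and \<beta>: "\<beta> \<in> keys (?t I)" by (rule UN_E)
    then have I: "I \<in> ?S" "I \<noteq> ?L" by simp_all
    have "finite I" using I(1) by (auto simp: subsets_of_card_def intro: finite_subset)
    from \<beta> have "\<beta> \<le> squarefree_exponent I"
      by (rule lex_monic_keysD[OF lex_monic_prod_var_plus_const[OF \<open>finite I\<close>]])
    also have "\<dots> < leading_exponent b k" using subset_leading_exponent_le(2)[OF assms(1) I] .
    finally show "\<beta> < leading_exponent b k" .
  qed
  ultimately show ?thesis by (simp only:)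
qed

section \<open>Values at the interpolation points\<close>

text \<open>
  With \<open>s = 2r\<close>, the value at \<open>\<rho> + \<mu>\<close> of the shifted elementary polynomial.
\<close>

definition shifted_value :: "'a::comm_ring_1 \<Rightarrow> (nat \<Rightarrow> nat) \<Rightarrow> nat set \<Rightarrow> nat \<Rightarrow> 'a" where
  "shifted_value s \<mu> A k = (\<Sum>I\<in>subsets_of_card A k. \<Prod>i\<in>I. of_nat (\<mu> i) + of_nat (later I i) * s)"

definition parity_support :: "nat \<Rightarrow> (nat \<Rightarrow> nat) \<Rightarrow> nat set" where
  "parity_support b \<mu> = {i. i mod 2 = b \<and> \<mu> i \<noteq> 0}"

lemma Lambda_antimono:
  assumes "\<mu> \<in> Lambda n" "1 \<le> i" "i \<le> j"
  shows "\<mu> j \<le> \<mu> i"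
  using assms(3)
proof (induction j rule: dec_induct)
  case (step j)
  have "\<mu> (Suc j) \<le> \<mu> j"
    using assms(1,2) step.hyps by (cases "j < n") (auto simp: Lambda_def)
  with step.IH show ?case by simp
qed simp

lemma Lambda_parity_support:
  assumes "\<mu> \<in> Lambda n"
  shows "parity_support b \<mu> \<subseteq> parity_class n b"
  using assms by (force simp: Lambda_def parity_support_def parity_class_def)

text \<open>
  At the last chosen index \<open>i\<close> the factor is \<open>\<mu>\<^sub>i\<close> itself. As \<open>\<mu>\<close> is weakly decreasing, a subset that
  contains an index with \<open>\<mu>\<^sub>i = 0\<close> therefore contributes nothing. So the number of variables no
  longer matters, and at small \<open>\<mu>\<close> at most one subset is left.
\<close>

lemma shifted_elementary_value:
  assumes "\<mu> \<in> Lambda n"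
  shows "poly_eval (shifted_elementary n r b k) (\<lambda>i. rho n r i + of_nat (\<mu> i)) =
    shifted_value (2 * r) \<mu> (parity_support b \<mu>) k"
proof -
  have "poly_eval (shifted_elementary n r b k) (\<lambda>i. rho n r i + of_nat (\<mu> i)) =
      shifted_value (2 * r) \<mu> (parity_class n b) k"
    by (simp add: poly_eval_shifted_elementary shifted_value_def algebra_simps)
  also have "\<dots> = shifted_value (2 * r) \<mu> (parity_support b \<mu>) k"
    unfolding shifted_value_def
  proof (rule sum.mono_neutral_right)
    show "subsets_of_card (parity_support b \<mu>) k \<subseteq> subsets_of_card (parity_class n b) k"
      using Lambda_parity_support[OF assms, of b] by (auto simp: subsets_of_card_def)
    show "\<forall>I\<in>subsets_of_card (parity_class n b) k - subsets_of_card (parity_support b \<mu>) k.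
        (\<Prod>i\<in>I. of_nat (\<mu> i) + of_nat (later I i) * (2 * r)) = 0"
    proof
      fix I assume "I \<in> subsets_of_card (parity_class n b) k - subsets_of_card (parity_support b \<mu>) k"
      then have I: "I \<subseteq> parity_class n b" "\<not> I \<subseteq> parity_support b \<mu>" by (auto simp: subsets_of_card_def)
      then have fin: "finite I" by (auto intro: finite_subset)
      from I obtain i where i: "i \<in> I" "\<mu> i = 0" by (auto simp: parity_support_def parity_class_def)
      let ?m = "Max I"
      have m: "?m \<in> I" "i \<le> ?m" using i fin by (auto intro: Max_in)
      have "1 \<le> i" using i I(1) by (auto simp: parity_class_def)
      then have "\<mu> ?m = 0" using Lambda_antimono[OF assms _ m(2)] i(2) by simp
      moreover have "{u \<in> I. ?m < u} = {}" using fin by (auto simp: not_less)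
      then have "later I ?m = 0" by (simp only: later_def card.empty)
      ultimately show "(\<Prod>i\<in>I. of_nat (\<mu> i) + of_nat (later I i) * (2 * r)) = 0"
        using fin m(1) by (intro prod_zero bexI[of _ ?m]) simp_all
    qed
  qed simp
  finally show ?thesis .
qed

lemma shifted_value_full:
  assumes "finite A" "card A = k"
  shows "shifted_value s \<mu> A k = (\<Prod>i\<in>A. of_nat (\<mu> i) + of_nat (later A i) * s)"
proof -
  have "subsets_of_card A k = {A}"
    using assms card_subset_eq[OF assms(1)] by (auto simp: subsets_of_card_def)
  then show ?thesis by (simp add: shifted_value_def)
qed

lemma shifted_value_1: "shifted_value s \<mu> A 1 = of_nat (\<Sum>i\<in>A. \<mu> i)"
proof -
  have "subsets_of_card A 1 = (\<lambda>i. {i}) ` A"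
    by (auto simp: subsets_of_card_def card_1_singleton_iff)
  moreover have "inj_on (\<lambda>i. {i}) A" by simp
  moreover have "later {i} i = 0" for i
  proof -
    have "{u \<in> {i}. i < u} = {}" by auto
    then show ?thesis by (simp only: later_def card.empty)
  qed
  ultimately show ?thesis
    by (simp add: shifted_value_def sum.reindex)
qed

lemma later_image_Suc: "later (Suc ` I) (Suc i) = later I i"
proof -
  have "{u \<in> Suc ` I. Suc i < u} = Suc ` {u \<in> I. i < u}" by auto
  then show ?thesis by (simp add: later_def card_image)
qed

lemma shifted_value_image_Suc:
  "shifted_value s \<mu> (Suc ` A) k = shifted_value s (\<lambda>i. \<mu> (Suc i)) A k"
proof -
  have "bij_betw ((`) Suc) (subsets_of_card A k) (subsets_of_card (Suc ` A) k)"
  proof (rule bij_betwI')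
    show "(Suc ` I = Suc ` J) = (I = J)" for I J by (simp add: inj_image_eq_iff)
    show "Suc ` I \<in> subsets_of_card (Suc ` A) k" if "I \<in> subsets_of_card A k" for I
      using that by (auto simp: subsets_of_card_def card_image)
    show "\<exists>I\<in>subsets_of_card A k. J = Suc ` I" if J: "J \<in> subsets_of_card (Suc ` A) k" for J
    proof -
      have "J \<subseteq> Suc ` A" using J by (simp add: subsets_of_card_def)
      then obtain I where "I \<subseteq> A" "J = Suc ` I" by (rule subset_imageE)
      then show ?thesis using J by (auto simp: subsets_of_card_def card_image)
    qed
  qed
  from sum.reindex_bij_betw[OF this, of "\<lambda>I. \<Prod>i\<in>I. of_nat (\<mu> i) + of_nat (later I i) * s"]
  show ?thesis by (simp add: shifted_value_def prod.reindex later_image_Suc)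
qed

lemma shifted_value_cong:
  assumes "\<And>i. i \<in> A \<Longrightarrow> \<mu> i = \<nu> i"
  shows "shifted_value s \<mu> A k = shifted_value s \<nu> A k"
  unfolding shifted_value_def using assms
  by (intro sum.cong prod.cong refl) (auto simp: subsets_of_card_def)

text \<open>
  Extra vanishing: only subsets of the support contribute, and the support is an initial segment of
  its parity class, so it has \<open>k\<close> elements only if it contains the first \<open>k\<close> indices.
\<close>

lemma shifted_value_nonzeroD:
  assumes "\<mu> \<in> Lambda n" "b < 2" "shifted_value s \<mu> (parity_support b \<mu>) k \<noteq> 0" "i \<in> parity_class (2 * k) b"
  shows "1 \<le> \<mu> i"
proof (rule ccontr)
  assume "\<not> 1 \<le> \<mu> i"
  then have zero: "\<mu> i = 0" by simp
  from assms(3) have "subsets_of_card (parity_support b \<mu>) k \<noteq> {}"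
    by (auto simp: shifted_value_def)
  then obtain I where I: "I \<subseteq> parity_support b \<mu>" "card I = k" by (auto simp: subsets_of_card_def)
  have "I \<subseteq> parity_class (2 * k) b - {i}"
  proof
    fix j assume "j \<in> I"
    then have j: "\<mu> j \<noteq> 0" "j \<in> parity_class n b"
      using I Lambda_parity_support[OF assms(1), of b] by (auto simp: parity_support_def)
    have "1 \<le> i" using assms(4) by (simp add: parity_class_def)
    then have "\<not> i \<le> j" using Lambda_antimono[OF assms(1), of i j] zero j(1) by auto
    then have "j < i" by simp
    then show "j \<in> parity_class (2 * k) b - {i}" using assms(4) j(2) by (auto simp: parity_class_def)
  qed
  then have "card I \<le> card (parity_class (2 * k) b - {i})" by (intro card_mono) auto
  also have "\<dots> < k"
    using assms(4) card_parity_class_even[OF assms(2), of k] by (metis card_Diff1_less finite_parity_class)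
  finally show False using I(2) by simp
qed

lemma shifted_value_equal_pairs:
  assumes "\<mu> \<in> Lambda n" "\<And>i. odd i \<Longrightarrow> \<mu> (Suc i) = \<mu> i"
  shows "shifted_value s \<mu> (parity_support 0 \<mu>) k = shifted_value s \<mu> (parity_support 1 \<mu>) k"
proof -
  have "parity_support 0 \<mu> = Suc ` parity_support 1 \<mu>"
  proof (intro equalityI subsetI)
    fix i assume i: "i \<in> parity_support 0 \<mu>"
    moreover have "\<mu> 0 = 0" using assms(1) by (simp add: Lambda_def)
    ultimately have "i \<noteq> 0" by (cases "i = 0") (auto simp: parity_support_def)
    then obtain j where "i = Suc j" by (cases i) auto
    then show "i \<in> Suc ` parity_support 1 \<mu>"
      using i assms(2)[of j] by (auto simp: parity_support_def odd_iff_mod_2_eq_one mod_Suc split: if_splits)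
  next
    fix i assume "i \<in> Suc ` parity_support 1 \<mu>"
    then show "i \<in> parity_support 0 \<mu>" using assms(2) by (auto simp: parity_support_def odd_iff_mod_2_eq_one mod_Suc)
  qed
  then have "shifted_value s \<mu> (parity_support 0 \<mu>) k = shifted_value s (\<lambda>i. \<mu> (Suc i)) (parity_support 1 \<mu>) k"
    by (simp add: shifted_value_image_Suc)
  also have "\<dots> = shifted_value s \<mu> (parity_support 1 \<mu>) k"
    by (rule shifted_value_cong) (simp add: parity_support_def assms(2) odd_iff_mod_2_eq_one)
  finally show ?thesis .
qed

section \<open>Leading exponents and sizes of columns and hooks\<close>

lemma bracket_rec: "i \<le> n \<Longrightarrow> bracket n l i = int (l i) - bracket n l (Suc i)"
proof -
  assume i: "i \<le> n"
  have "(\<Sum>j=Suc i..n. (-1) ^ (j - i) * int (l j)) = (\<Sum>j=Suc i..n. - ((-1) ^ (j - Suc i) * int (l j)))"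
  proof (rule sum.cong)
    fix j assume "j \<in> {Suc i..n}"
    then have "j - i = Suc (j - Suc i)" by auto
    then show "(-1) ^ (j - i) * int (l j) = - ((-1) ^ (j - Suc i) * int (l j))" by simp
  qed simp
  then show ?thesis using i by (simp add: bracket_def sum.atLeast_Suc_atMost sum_negf)
qed

lemma bracket_column:
  assumes "b \<le> n" "1 \<le> i"
  shows "bracket n (column b) i = (if i \<le> b \<and> even (b - i) then 1 else 0)"
  using assms(2)
proof (induction "Suc n - i" arbitrary: i)
  case 0
  then show ?case using assms(1) by (simp add: bracket_def)
next
  case (Suc d)
  then have "i \<le> n" and IH: "bracket n (column b) (Suc i) = (if Suc i \<le> b \<and> even (b - Suc i) then 1 else 0)"
    by auto
  then show ?case
    using Suc.prems bracket_rec[of i n "column b"]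
    by (cases "i < b") (auto simp: column_def Suc_diff_Suc[symmetric])
qed

lemma bracket_hook:
  assumes "1 \<le> n" "1 \<le> a" "1 \<le> m" "1 \<le> i"
  shows "bracket n (hook a (m - 1)) i = bracket n (column m) i + (if i = 1 then int a - 1 else 0)"
proof -
  have ge2: "bracket n (hook a (m - 1)) i = bracket n (column m) i" if "2 \<le> i" for i
    unfolding bracket_def using that assms(3)
    by (intro sum.cong) (auto simp: hook_def column_def)
  show ?thesis
  proof (cases "i = 1")
    case True
    then show ?thesis
      using ge2[of 2] assms bracket_rec[of 1 n "hook a (m - 1)"] bracket_rec[of 1 n "column m"]
      by (simp add: hook_def column_def numeral_2_eq_2)
  qed (use assms(4) ge2 in auto)
qed

lemma lookup_bracket_exponent:
  "lookup (bracket_exponent n l) i = (if i \<in> {1..n} then nat (bracket n l i) else 0)"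
  by (simp add: bracket_exponent_def lookup_sum lookup_single when_def)

lemma bracket_exponent_column_even:
  assumes "2 * k \<le> n"
  shows "bracket_exponent n (column (2 * k)) = leading_exponent 0 k"
proof (rule poly_mapping_eqI)
  fix i show "lookup (bracket_exponent n (column (2 * k))) i = lookup (leading_exponent 0 k) i"
    using assms by (auto simp: lookup_bracket_exponent lookup_leading_exponent bracket_column parity_class_def
        mod_2_eq_odd)
qed

lemma bracket_exponent_column_odd:
  assumes "2 * k + 1 \<le> n"
  shows "bracket_exponent n (column (2 * k + 1)) = leading_exponent 1 (k + 1)"
proof (rule poly_mapping_eqI)
  fix i
  have "i \<le> 2 * k + 1 \<longleftrightarrow> i \<le> 2 * (k + 1)" if "odd i" using that by (auto simp: le_Suc_eq)
  then show "lookup (bracket_exponent n (column (2 * k + 1))) i = lookup (leading_exponent 1 (k + 1)) i"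
    using assms by (auto simp: lookup_bracket_exponent lookup_leading_exponent bracket_column parity_class_def
        mod_2_eq_odd)
qed

lemma bracket_exponent_hook:
  assumes "1 \<le> a" "1 \<le> k" "2 * k \<le> n"
  shows "bracket_exponent n (hook a (2 * k - 1)) = single 1 (a - 1) + leading_exponent 0 k"
proof (rule poly_mapping_eqI)
  fix i
  have "lookup (bracket_exponent n (hook a (2 * k - 1))) i =
      lookup (bracket_exponent n (column (2 * k))) i + (if i = 1 then a - 1 else 0)"
    using assms bracket_hook[of n a "2 * k" i]
    by (auto simp: lookup_bracket_exponent bracket_column nat_add_distrib nat_diff_distrib)
  then show "lookup (bracket_exponent n (hook a (2 * k - 1))) i = lookup (single 1 (a - 1) + leading_exponent 0 k) i"
    using bracket_exponent_column_even[OF assms(3)]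
    by (simp add: lookup_add lookup_single when_def)
qed

lemma mdeg_leading_exponent: "b < 2 \<Longrightarrow> mdeg (leading_exponent b k) = k"
proof -
  assume "b < 2"
  have "keys (leading_exponent b k) = parity_class (2 * k) b"
    by (auto simp: in_keys_iff lookup_leading_exponent split: if_splits)
  then have "mdeg (leading_exponent b k) = card (parity_class (2 * k) b)"
    by (simp add: mdeg_def lookup_leading_exponent)
  then show ?thesis using card_parity_class_even[OF \<open>b < 2\<close>] by simp
qed

lemma odd_size_eq_sum: "odd_size n \<mu> = sum \<mu> (parity_class n 1)"
  unfolding odd_size_def parity_class_def by (rule sum.cong) (auto simp: odd_iff_mod_2_eq_one)

lemma parity_class_mono: "m \<le> n \<Longrightarrow> parity_class m b \<subseteq> parity_class n b"
  by (auto simp: parity_class_def)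

lemma parity_class_odd_top: "parity_class (2 * (k + 1)) 1 = parity_class (2 * k + 1) 1"
proof -
  have "2 * (k + 1) = Suc (2 * k + 1)" "Suc (2 * k + 1) mod 2 = 0" by simp_all
  then show ?thesis by (simp only: parity_class_Suc) simp
qed

lemma odd_size_column_even:
  assumes "2 * k \<le> n"
  shows "odd_size n (column (2 * k)) = k"
proof -
  have "odd_size n (column (2 * k)) = (\<Sum>i\<in>parity_class (2 * k) 1. 1)"
    unfolding odd_size_eq_sum using assms
    by (intro sum.mono_neutral_cong_right) (auto simp: parity_class_def column_def)
  then show ?thesis using card_parity_class_even[of 1 k] by simp
qed

lemma odd_size_column_odd:
  assumes "2 * k + 1 \<le> n"
  shows "odd_size n (column (2 * k + 1)) = k + 1"
proof -
  have "odd_size n (column (2 * k + 1)) = (\<Sum>i\<in>parity_class (2 * k + 1) 1. 1)"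
    unfolding odd_size_eq_sum using assms
    by (intro sum.mono_neutral_cong_right) (auto simp: parity_class_def column_def)
  then show ?thesis
    using card_parity_class_even[of 1 "k + 1"] unfolding parity_class_odd_top by simp
qed

lemma odd_size_hook:
  assumes "1 \<le> n" "1 \<le> a" "1 \<le> m"
  shows "odd_size n (hook a (m - 1)) = odd_size n (column m) + (a - 1)"
proof -
  have 1: "1 \<in> parity_class n 1" using assms(1) by (simp add: parity_class_def)
  have "(\<Sum>i\<in>parity_class n 1 - {1}. hook a (m - 1) i) = (\<Sum>i\<in>parity_class n 1 - {1}. column m i)"
    using assms(3) by (intro sum.cong) (auto simp: hook_def column_def parity_class_def)
  moreover have "hook a (m - 1) 1 = column m 1 + (a - 1)"
    using assms by (simp add: hook_def column_def)
  ultimately show ?thesis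
    using sum.remove[OF finite_parity_class 1, of "hook a (m - 1)"]
      sum.remove[OF finite_parity_class 1, of "column m"]
    unfolding odd_size_eq_sum by linarith
qed

lemma column_in_Lambda: "b \<le> n \<Longrightarrow> column b \<in> Lambda n"
  by (auto simp: Lambda_def column_def)

lemma hook_in_Lambda: "1 \<le> a \<Longrightarrow> b < n \<Longrightarrow> hook a b \<in> Lambda n"
  by (auto simp: Lambda_def hook_def)

lemma is_semisymI:
  fixes r :: "'a::field_char_0"
  assumes "p \<in> invariants n" "p \<in> polys_le n (odd_size n l)"
    and "lex_monic p (bracket_exponent n l)" "mdeg (bracket_exponent n l) = odd_size n l"
    and "\<And>\<mu>. \<mu> \<in> Lambda n \<Longrightarrow> odd_size n \<mu> \<le> odd_size n l \<Longrightarrow> \<mu> \<noteq> l \<Longrightarrow>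
      poly_eval p (\<lambda>i. rho n r i + of_nat (\<mu> i)) = 0"
  shows "is_semisym n r l p"
proof -
  have "lookup p (bracket_exponent n l) = 1" using assms(3) by (simp add: lex_monic_def)
  then have "bracket_exponent n l \<in> keys p" by (simp add: in_keys_iff)
  then have "odd_size n l \<le> total_degree p"
    using assms(4) total_degree_le_iff[of p "total_degree p"] by auto
  then show ?thesis using assms by (simp add: is_semisym_def lex_monic_def polys_le_iff)
qed

lemma one_less_two_nat: "(1::nat) < 2" by simp

section \<open>The polynomials of columns\<close>

lemma tight_sum:
  fixes f :: "'b \<Rightarrow> nat"
  assumes "finite A" "B \<subseteq> A" "sum f A \<le> card B" "\<And>i. i \<in> B \<Longrightarrow> 1 \<le> f i"
  shows "(\<forall>i\<in>B. f i = 1) \<and> (\<forall>i\<in>A - B. f i = 0)"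
proof -
  have fin: "finite B" using assms(1,2) finite_subset by blast
  have "sum f A = sum f (A - B) + sum f B" using sum.subset_diff[OF assms(2,1)] .
  moreover have "sum f B = (\<Sum>i\<in>B. (f i - 1) + 1)" 
    by (intro sum.cong refl le_add_diff_inverse2[symmetric] assms(4))
  then have "sum f B = (\<Sum>i\<in>B. f i - 1) + card B" by (simp add: sum.distrib sum_Suc)
  ultimately have "sum f (A - B) = 0" "(\<Sum>i\<in>B. f i - 1) = 0" using assms(3) by linarith+
  then have "\<forall>i\<in>A - B. f i = 0" "\<forall>i\<in>B. f i - 1 = 0" using assms(1) fin by auto
  moreover have "f i = 1" if "i \<in> B" "f i - 1 = 0" for i using assms(4)[OF that(1)] that(2) by simp
  ultimately show ?thesis by blast
qed

lemma Lambda_eq_columnI: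
  assumes "\<mu> \<in> Lambda n" "\<mu> 1 \<le> 1" "b = 0 \<or> 1 \<le> \<mu> b" "\<mu> (Suc b) = 0"
  shows "\<mu> = column b"
proof
  fix i
  consider "i = 0" | "1 \<le> i" "i \<le> b" | "b < i" by linarith
  then show "\<mu> i = column b i"
  proof cases
    case 1
    then show ?thesis using assms(1) by (simp add: Lambda_def column_def)
  next
    case 2
    then show ?thesis
      using Lambda_antimono[OF assms(1), of i b] Lambda_antimono[OF assms(1), of 1 i] assms(2,3)
      by (auto simp: column_def)
  next
    case 3
    then show ?thesis using Lambda_antimono[OF assms(1), of "Suc b" i] assms(4) by (simp add: column_def)
  qed
qed

text \<open>
  If the parts of one parity sum to at most \<open>k\<close> while the first \<open>k\<close> of them are nonzero, they are
  all determined. This is how the size bound isolates the few tuples at which vanishing needs an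
  argument.
\<close>

lemma Lambda_tight:
  assumes "\<mu> \<in> Lambda n" "b < 2" "1 \<le> M" "1 \<le> \<mu> M" "sum \<mu> (parity_class n b) \<le> k"
    and "parity_class (2 * k) b \<subseteq> {1..M}" "M \<le> n"
  shows "i \<in> parity_class (2 * k) b \<Longrightarrow> \<mu> i = 1"
    and "i mod 2 = b \<Longrightarrow> i \<notin> parity_class (2 * k) b \<Longrightarrow> \<mu> i = 0"
proof -
  have "parity_class (2 * k) b \<subseteq> parity_class n b" using assms(6,7) by (auto simp: parity_class_def)
  then have *: "(\<forall>i\<in>parity_class (2 * k) b. \<mu> i = 1) \<and> (\<forall>i\<in>parity_class n b - parity_class (2 * k) b. \<mu> i = 0)"
  proof (intro tight_sum)
    show "sum \<mu> (parity_class n b) \<le> card (parity_class (2 * k) b)"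
      using assms(5) card_parity_class_even[OF assms(2), of k] by simp
    show "1 \<le> \<mu> i" if "i \<in> parity_class (2 * k) b" for i
      using that assms(4,6) Lambda_antimono[OF assms(1), of i M] by force
  qed simp_all
  show "\<mu> i = 1" if "i \<in> parity_class (2 * k) b" using * that by blast
  show "\<mu> i = 0" if "i mod 2 = b" "i \<notin> parity_class (2 * k) b"
    using * that assms(1) by (cases "i \<in> {1..n}") (auto simp: parity_class_def Lambda_def)
qed

text \<open>
  A nonzero value needs nonzero parts at the first \<open>k\<close> even indices, hence also at the first \<open>k\<close> odd
  ones. If these sum to at most \<open>k\<close>, all of them are \<open>1\<close> and there is no part after \<open>\<mu>\<^bsub>2k\<^esub>\<close>.
\<close>

theorem R_column_even:
  fixes r :: "'a::field_char_0"
  assumes r: "\<forall>q::rat. q < 0 \<longrightarrow> r \<noteq> of_rat q" and k: "1 \<le> k" "2 * k \<le> n"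
  shows "R n r (column (2 * k)) = shifted_elementary n r 0 k"
proof (rule R_eqI[OF r column_in_Lambda[OF k(2)]], rule is_semisymI)
  let ?l = "column (2 * k)"
  show "shifted_elementary n r 0 k \<in> invariants n" by (rule shifted_elementary_invariant)
  show "shifted_elementary n r 0 k \<in> polys_le n (odd_size n ?l)"
    by (simp add: odd_size_column_even k shifted_elementary_polys_le)
  show "lex_monic (shifted_elementary n r 0 k) (bracket_exponent n ?l)"
    unfolding bracket_exponent_column_even[OF k(2)]
    using k(2) by (intro lex_monic_shifted_elementary) (auto simp: parity_class_def)
  show "mdeg (bracket_exponent n ?l) = odd_size n ?l"
    by (simp add: bracket_exponent_column_even odd_size_column_even k mdeg_leading_exponent)
  fix \<mu> assume \<mu>: "\<mu> \<in> Lambda n" "odd_size n \<mu> \<le> odd_size n ?l" "\<mu> \<noteq> ?l"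
  show "poly_eval (shifted_elementary n r 0 k) (\<lambda>i. rho n r i + of_nat (\<mu> i)) = 0"
  proof (rule ccontr)
    assume "poly_eval (shifted_elementary n r 0 k) (\<lambda>i. rho n r i + of_nat (\<mu> i)) \<noteq> 0"
    then have "shifted_value (2 * r) \<mu> (parity_support 0 \<mu>) k \<noteq> 0"
      by (simp add: shifted_elementary_value[OF \<mu>(1)])
    then have pos: "1 \<le> \<mu> (2 * k)"
      by (rule shifted_value_nonzeroD[OF \<mu>(1) zero_less_numeral]) (use k(1) in \<open>auto simp: parity_class_def\<close>)
    have size: "sum \<mu> (parity_class n 1) \<le> k"
      using \<mu>(2)[unfolded odd_size_column_even[OF k(2)]] unfolding odd_size_eq_sum .
    have "1 \<le> 2 * k" "parity_class (2 * k) 1 \<subseteq> {1..2 * k}"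
      using k(1) by (auto simp: parity_class_def)
    note tight = Lambda_tight[OF \<mu>(1) one_less_two_nat this(1) pos size this(2) k(2)]
    have "\<mu> = ?l"
    proof (rule Lambda_eq_columnI[OF \<mu>(1)])
      show "\<mu> 1 \<le> 1" using tight(1)[of 1] k(1) by (auto simp: parity_class_def)
      show "\<mu> (Suc (2 * k)) = 0" using tight(2)[of "Suc (2 * k)"] k(1) by (auto simp: parity_class_def)
    qed (use pos in auto)
    with \<mu>(3) show False ..
  qed
qed

text \<open>
  For \<open>|\<mu>|\<^sub>o\<^sub>d\<^sub>d \<le> k + 1\<close> the polynomial in the odd variables can be nonzero only at the two
  columns of lengths \<open>2k + 1\<close> and \<open>2k + 2\<close>. Subtracting its counterpart in the even variables cancels the
  value at the second one, where odd and even parts coincide. When \<open>2k + 1 > n\<close> both are empty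
  sums, in agreement with the convention.
\<close>

theorem R_column_odd:
  fixes r :: "'a::field_char_0"
  assumes r: "\<forall>q::rat. q < 0 \<longrightarrow> r \<noteq> of_rat q"
  shows "R n r (column (2 * k + 1)) = shifted_elementary n r 1 (k + 1) - shifted_elementary n r 0 (k + 1)"
proof (cases "2 * k + 1 \<le> n")
  case False
  have "shifted_elementary n r b (k + 1) = 0" if "b < 2" for b
  proof -
    have "card I < k + 1" if "I \<subseteq> parity_class n b" for I
    proof -
      have "I \<subseteq> parity_class (2 * k) b" using that False parity_class_mono[of n "2 * k" b] by auto
      then have "card I \<le> card (parity_class (2 * k) b)" by (intro card_mono) auto
      then show ?thesis using card_parity_class_even[OF \<open>b < 2\<close>, of k] by simp
    qed
    then have "subsets_of_card (parity_class n b) (k + 1) = {}"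
      unfolding subsets_of_card_def by (metis (mono_tags, lifting) Collect_empty_eq less_irrefl)
    then show ?thesis by (simp add: shifted_elementary_def)
  qed
  moreover have "column (2 * k + 1) \<notin> Lambda n"
  proof
    assume "column (2 * k + 1) \<in> Lambda n"
    then have "column (2 * k + 1) (2 * k + 1) = 0" using False by (simp add: Lambda_def)
    then show False by (simp add: column_def)
  qed
  ultimately show ?thesis by (simp add: R_def)
next
  case True
  let ?l = "column (2 * k + 1)"
  let ?p = "shifted_elementary n r 1 (k + 1) - shifted_elementary n r 0 (k + 1)"
  show ?thesis
  proof (rule R_eqI[OF r column_in_Lambda[OF True]], rule is_semisymI)
    show "?p \<in> polys_le n (odd_size n ?l)"
      unfolding odd_size_column_odd[OF True]
      by (intro polys_le_diff shifted_elementary_polys_le)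
    then show "?p \<in> invariants n"
      using shifted_elementary_invariant[of n r 1 "k + 1"] shifted_elementary_invariant[of n r 0 "k + 1"]
      unfolding invariants_iff_eval by (simp add: polys_le_ring)
    show "lex_monic ?p (bracket_exponent n ?l)"
      unfolding bracket_exponent_column_odd[OF True]
    proof (rule lex_monic_diff)
      have "parity_class (2 * (k + 1)) 1 \<subseteq> {1..n}"
        unfolding parity_class_odd_top using True by (auto simp: parity_class_def)
      then show "lex_monic (shifted_elementary n r 1 (k + 1)) (leading_exponent 1 (k + 1))"
        by (intro lex_monic_shifted_elementary) auto
      fix \<beta> assume "\<beta> \<in> keys (shifted_elementary n r 0 (k + 1))"
      then have "\<beta> \<le> leading_exponent 0 (k + 1)" by (intro keys_shifted_elementary_le) auto
      also have "\<dots> < leading_exponent 1 (k + 1)"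
        by (rule lex_lessI[of _ 1]) (auto simp: lookup_leading_exponent parity_class_def)
      finally show "\<beta> < leading_exponent 1 (k + 1)" .
    qed
    show "mdeg (bracket_exponent n ?l) = odd_size n ?l"
      using True by (simp only: bracket_exponent_column_odd odd_size_column_odd mdeg_leading_exponent[OF one_less_two_nat])
    fix \<mu> assume \<mu>: "\<mu> \<in> Lambda n" "odd_size n \<mu> \<le> odd_size n ?l" "\<mu> \<noteq> ?l"
    let ?h = "\<lambda>b. shifted_value (2 * r) \<mu> (parity_support b \<mu>) (k + 1)"
    have "?h 1 = ?h 0"
    proof (rule ccontr)
      assume ne: "?h 1 \<noteq> ?h 0"
      have "1 \<le> \<mu> (2 * k + 1)"
      proof (cases "?h 1 = 0")
        case False
        then show ?thesis
          by (rule shifted_value_nonzeroD[OF \<mu>(1) one_less_two_nat]) (auto simp: parity_class_def)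
      next
        case True
        with ne have "?h 0 \<noteq> 0" by simp
        then have "1 \<le> \<mu> (2 * k + 2)"
          by (rule shifted_value_nonzeroD[OF \<mu>(1) zero_less_numeral]) (auto simp: parity_class_def)
        then show ?thesis using Lambda_antimono[OF \<mu>(1), of "2 * k + 1" "2 * k + 2"] by simp
      qed
      note pos = this
      have size: "sum \<mu> (parity_class n 1) \<le> k + 1"
        using \<mu>(2)[unfolded odd_size_column_odd[OF True]] unfolding odd_size_eq_sum .
      have sub: "parity_class (2 * (k + 1)) 1 \<subseteq> {1..2 * k + 1}"
        unfolding parity_class_odd_top by (auto simp: parity_class_def)
      note tight = Lambda_tight[OF \<mu>(1) one_less_two_nat _ pos size sub True]
      have one: "\<mu> 1 = 1" by (rule tight(1)) (auto simp: parity_class_def)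
      have top: "\<mu> (2 * k + 3) = 0" by (rule tight(2)) (auto simp: parity_class_def)
      have "\<mu> (2 * k + 2) \<noteq> 0"
        using Lambda_eq_columnI[OF \<mu>(1), of "2 * k + 1"] one pos \<mu>(3) by auto
      then have "\<mu> = column (2 * k + 2)"
        using one top by (intro Lambda_eq_columnI[OF \<mu>(1)]) (auto simp: eval_nat_numeral)
      then have "\<mu> (Suc i) = \<mu> i" if "odd i" for i
        using that by (auto simp: column_def elim!: oddE)
      then have "?h 0 = ?h 1" by (rule shifted_value_equal_pairs[OF \<mu>(1)])
      with ne show False by simp
    qed
    then show "poly_eval ?p (\<lambda>i. rho n r i + of_nat (\<mu> i)) = 0"
      by (simp add: shifted_elementary_value[OF \<mu>(1)])
  qed
qed

section \<open>The polynomials of hooks\<close>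

text \<open>
  Compare \<open>\<mu>\<^sub>i\<close> and \<open>\<mu>\<^bsub>i+1\<^esub>\<close> for odd \<open>i\<close>; if \<open>n\<close> is odd, the last odd part is paired with \<open>0\<close>.
\<close>

lemma sum_even_le_sum_odd:
  assumes "\<mu> \<in> Lambda n"
  shows "sum \<mu> (parity_class n 0) \<le> sum \<mu> (parity_class n 1)"
    and "sum \<mu> (parity_class n 0) = sum \<mu> (parity_class n 1) \<Longrightarrow> odd i \<Longrightarrow> \<mu> (Suc i) = \<mu> i"
proof -
  have "sum \<mu> (parity_class n 0) = sum \<mu> (Suc ` parity_class n 1)"
  proof (rule sum.mono_neutral_left)
    show "parity_class n 0 \<subseteq> Suc ` parity_class n 1"
    proof
      fix j assume j: "j \<in> parity_class n 0"
      then obtain i where i: "j = Suc i" by (cases j) (auto simp: parity_class_def)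
      then have "i \<in> parity_class n 1"
        using j by (cases "i = 0") (auto simp: parity_class_def mod_2_eq_odd)
      then show "j \<in> Suc ` parity_class n 1" using i by blast
    qed
    show "\<forall>j\<in>Suc ` parity_class n 1 - parity_class n 0. \<mu> j = 0"
    proof
      fix j assume j: "j \<in> Suc ` parity_class n 1 - parity_class n 0"
      then have "even j" by (auto simp: parity_class_def mod_2_eq_odd)
      then have "j \<notin> {1..n}" using j by (auto simp: parity_class_def)
      then show "\<mu> j = 0" using assms by (simp add: Lambda_def)
    qed
  qed simp
  also have "\<dots> = (\<Sum>i\<in>parity_class n 1. \<mu> (Suc i))" by (simp add: sum.reindex)
  finally have eq: "sum \<mu> (parity_class n 0) = (\<Sum>i\<in>parity_class n 1. \<mu> (Suc i))" .
  have le: "\<mu> (Suc i) \<le> \<mu> i" if "i \<in> parity_class n 1" for i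
    using that Lambda_antimono[OF assms, of i "Suc i"] by (simp add: parity_class_def)
  show "sum \<mu> (parity_class n 0) \<le> sum \<mu> (parity_class n 1)"
    unfolding eq by (rule sum_mono) (rule le)
  show "\<mu> (Suc i) = \<mu> i" if "sum \<mu> (parity_class n 0) = sum \<mu> (parity_class n 1)" "odd i"
  proof (cases "i \<in> parity_class n 1")
    case True
    show ?thesis
      by (rule sum_mono_inv[OF that(1)[unfolded eq] le True]) simp_all
  next
    case False
    moreover have "i \<noteq> 0" using that(2) by (intro notI) simp
    ultimately have "n < i" using that(2) by (auto simp: parity_class_def mod_2_eq_odd)
    then show ?thesis using assms by (simp add: Lambda_def)
  qed
qed

lemma sum_parity_support: "\<mu> \<in> Lambda n \<Longrightarrow> sum \<mu> (parity_support b \<mu>) = sum \<mu> (parity_class n b)"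
  by (rule sum.mono_neutral_left[OF finite_parity_class Lambda_parity_support])
    (auto simp: parity_support_def parity_class_def)

text \<open>
  Both sides consist of a single product. Moving the indices \<open>2, 4, \<dots>, 2k\<close> up by one matches all
  factors except the one at index \<open>1\<close>, which has \<open>k\<close> later indices.
\<close>

lemma shifted_value_ratio:
  assumes "parity_support 0 \<mu> = parity_class (2 * k) 0"
    and "parity_support 1 \<mu> = parity_class (2 * k + 1) 1" "\<And>i. i \<in> {2..2 * k + 1} \<Longrightarrow> \<mu> i = 1"
  shows "shifted_value s \<mu> (parity_support 1 \<mu>) (k + 1) =
    (of_nat (\<mu> 1) + of_nat k * s) * shifted_value s \<mu> (parity_support 0 \<mu>) k"
proof -
  let ?S = "parity_class (2 * k) 0"
  have T: "parity_class (2 * k + 1) 1 = insert 1 (Suc ` ?S)"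
  proof (intro equalityI subsetI)
    fix i assume i: "i \<in> parity_class (2 * k + 1) 1"
    then obtain j where j: "i = Suc j" by (cases i) (auto simp: parity_class_def)
    then have "even j" using i by (cases "even j") (auto simp: parity_class_def mod_2_eq_odd)
    then show "i \<in> insert 1 (Suc ` ?S)" using i j by (cases "j = 0") (auto simp: parity_class_def)
  qed (auto simp: parity_class_def mod_2_eq_odd)
  have "1 \<notin> Suc ` ?S" by (auto simp: parity_class_def)
  have "{u \<in> insert 1 (Suc ` ?S). 1 < u} = Suc ` ?S" by (auto simp: parity_class_def)
  then have later_1: "later (insert 1 (Suc ` ?S)) 1 = k"
    using card_parity_class_even[of 0 k] by (simp add: later_def card_image del: One_nat_def)
  have later_Suc: "later (insert 1 (Suc ` ?S)) (Suc i) = later ?S i" for i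
  proof -
    have "{u \<in> insert 1 (Suc ` ?S). Suc i < u} = Suc ` {u \<in> ?S. i < u}" by auto
    then show ?thesis by (simp add: later_def card_image)
  qed
  have "card (parity_class (2 * k + 1) 1) = k + 1"
    using card_parity_class_even[of 1 "k + 1"] unfolding parity_class_odd_top by simp
  then have "shifted_value s \<mu> (parity_support 1 \<mu>) (k + 1) =
      (\<Prod>i\<in>insert 1 (Suc ` ?S). of_nat (\<mu> i) + of_nat (later (insert 1 (Suc ` ?S)) i) * s)"
    unfolding assms(2) T[symmetric] by (intro shifted_value_full) simp_all
  also have "\<dots> = (of_nat (\<mu> 1) + of_nat k * s) *
      (\<Prod>i\<in>?S. of_nat (\<mu> (Suc i)) + of_nat (later ?S i) * s)"
    using \<open>1 \<notin> Suc ` ?S\<close> later_1 later_Suc by (simp add: prod.reindex del: One_nat_def)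
  also have "(\<Prod>i\<in>?S. of_nat (\<mu> (Suc i)) + of_nat (later ?S i) * s) =
      (\<Prod>i\<in>?S. of_nat (\<mu> i) + of_nat (later ?S i) * s)"
    using assms(3) by (intro prod.cong) (auto simp: parity_class_def Suc_le_eq)
  also have "\<dots> = shifted_value s \<mu> (parity_support 0 \<mu>) k"
    using assms(1) card_parity_class_even[of 0 k] by (simp add: shifted_value_full)
  finally show ?thesis .
qed

lemma Lambda_eq_hookI:
  assumes "\<mu> \<in> Lambda n" "\<And>i. i \<in> {2..b + 1} \<Longrightarrow> \<mu> i = 1" "\<mu> (b + 2) = 0"
  shows "\<mu> = hook (\<mu> 1) b"
proof
  fix i
  consider "i = 0" | "i = 1" | "i \<in> {2..b + 1}" | "b + 2 \<le> i" by fastforce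
  then show "\<mu> i = hook (\<mu> 1) b i"
  proof cases
    case 1
    then show ?thesis using assms(1) by (simp add: Lambda_def hook_def)
  next
    case 4
    then show ?thesis using Lambda_antimono[OF assms(1), of "b + 2" i] assms(3) by (simp add: hook_def)
  qed (use assms(2) in \<open>auto simp: hook_def\<close>)
qed

lemma shifted_value_hook:
  assumes "1 \<le> x" "\<mu> = hook x (2 * k)"
  shows "shifted_value s \<mu> (parity_support 1 \<mu>) (k + 1) = (of_nat x + of_nat k * s) * shifted_value s \<mu> (parity_support 0 \<mu>) k"
proof -
  have supp: "\<mu> i \<noteq> 0 \<longleftrightarrow> i \<in> {1..2 * k + 1}" for i
    using assms by (auto simp: hook_def)
  have "parity_support 0 \<mu> = parity_class (2 * k) 0"
    unfolding parity_support_def supp parity_class_def by (auto simp: le_Suc_eq)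
  moreover have "parity_support 1 \<mu> = parity_class (2 * k + 1) 1"
    unfolding parity_support_def supp parity_class_def by auto
  moreover have "\<mu> i = 1" if "i \<in> {2..2 * k + 1}" for i
    using that assms(2) by (auto simp: hook_def)
  moreover have "\<mu> 1 = x" using assms(2) by (simp add: hook_def)
  ultimately show ?thesis using shifted_value_ratio[of \<mu> k s] by simp
qed

text \<open>
  The even parts sum to at least \<open>k\<close>, so the two bounds on the odd sum are sharp: the even parts
  are \<open>1\<close> up to index \<open>2k\<close> and \<open>0\<close> afterwards, and only \<open>\<mu>\<^sub>1\<close> and \<open>\<mu>\<^bsub>2k+1\<^esub> \<in> {0, 1}\<close> remain free,
  with known sum.
\<close>

lemma Lambda_hook_cases:
  assumes \<mu>: "\<mu> \<in> Lambda n" and k: "1 \<le> k" "2 * k \<le> n" and pos: "1 \<le> \<mu> (2 * k)" and "2 \<le> a"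
    and size: "odd_size n \<mu> \<le> a - 1 + k"
    and diff: "a - 1 \<le> odd_size n \<mu> - sum \<mu> (parity_class n 0)"
  shows "(\<mu> = hook a (2 * k - 1) \<or> \<mu> = hook (a - 1) (2 * k)) \<and>
    odd_size n \<mu> - sum \<mu> (parity_class n 0) = a - 1"
proof -
  let ?e = "sum \<mu> (parity_class n 0)"
  have "1 \<le> n" using k by simp
  have le: "?e \<le> k" using diff size \<open>2 \<le> a\<close> by linarith
  have sub: "parity_class (2 * k) 0 \<subseteq> {1..2 * k}" and "1 \<le> 2 * k"
    using k(1) by (auto simp: parity_class_def)
  note tight = Lambda_tight[OF \<mu> zero_less_numeral \<open>1 \<le> 2 * k\<close> pos le sub k(2)]
  have two: "\<mu> 2 = 1" using k(1) by (intro tight(1)) (auto simp: parity_class_def)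
  have ones: "\<mu> i = 1" if "i \<in> {2..2 * k}" for i
    using that Lambda_antimono[OF \<mu>, of 2 i] Lambda_antimono[OF \<mu>, of i "2 * k"] two pos by auto
  have top: "\<mu> (2 * k + 2) = 0" by (rule tight(2)) (auto simp: parity_class_def)
  have pos1: "1 \<le> \<mu> 1" using Lambda_antimono[OF \<mu>, of 1 2] two by simp
  have "?e = (\<Sum>i\<in>parity_class (2 * k) 0. 1)"
  proof (rule sum.mono_neutral_cong_right)
    show "\<forall>i\<in>parity_class n 0 - parity_class (2 * k) 0. \<mu> i = 0"
    proof
      fix i assume i: "i \<in> parity_class n 0 - parity_class (2 * k) 0"
      then have "i mod 2 = 0" by (simp add: parity_class_def)
      then show "\<mu> i = 0" using i by (intro tight(2)) simp_all
    qed
  qed (use tight(1) parity_class_mono[OF k(2)] in auto)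
  then have e: "?e = k" using card_parity_class_even[of 0 k] by simp
  then have o: "odd_size n \<mu> = a - 1 + k" using diff size \<open>2 \<le> a\<close> by linarith
  have "\<mu> = hook a (2 * k - 1) \<or> \<mu> = hook (a - 1) (2 * k)"
  proof (cases "\<mu> (2 * k + 1) = 0")
    case True
    then have hook: "\<mu> = hook (\<mu> 1) (2 * k - 1)"
      using ones k(1) by (intro Lambda_eq_hookI[OF \<mu>]) auto
    have "odd_size n (hook (\<mu> 1) (2 * k - 1)) = k + (\<mu> 1 - 1)"
      unfolding odd_size_hook[OF \<open>1 \<le> n\<close> pos1 \<open>1 \<le> 2 * k\<close>] odd_size_column_even[OF k(2)] ..
    then have "\<mu> 1 = a" using o hook pos1 \<open>2 \<le> a\<close> by simp
    with hook show ?thesis by simp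
  next
    case False
    moreover have "\<mu> (2 * k + 1) \<le> 1"
      using Lambda_antimono[OF \<mu>, of 2 "2 * k + 1"] two k(1) by simp
    ultimately have last: "\<mu> (2 * k + 1) = 1" by simp
    then have n: "2 * k + 1 \<le> n" using \<mu> by (auto simp: Lambda_def intro: ccontr)
    have "\<mu> i = 1" if "i \<in> {2..2 * k + 1}" for i
      using that ones last by (cases "i = 2 * k + 1") auto
    then have hook: "\<mu> = hook (\<mu> 1) (2 * k)"
      using top by (intro Lambda_eq_hookI[OF \<mu>]) auto
    have "odd_size n (hook (\<mu> 1) (2 * k)) = k + 1 + (\<mu> 1 - 1)"
      using odd_size_hook[OF \<open>1 \<le> n\<close> pos1, of "2 * k + 1"] odd_size_column_odd[OF n] by simp
    then have "\<mu> 1 = a - 1" using o hook pos1 \<open>2 \<le> a\<close> by simp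
    with hook show ?thesis by simp
  qed
  with e o show ?thesis by simp
qed

lemma lex_monic_column_1:
  fixes r :: "'a::comm_ring_1"
  assumes "1 \<le> n"
  shows "lex_monic (shifted_elementary n r 1 1 - shifted_elementary n r 0 1) (single 1 1)"
proof -
  have one_class: "parity_class (2 * 1) 1 = {1}"
    by (auto simp: parity_class_def numeral_2_eq_2 le_Suc_eq)
  have "leading_exponent 1 1 = single 1 1"
    unfolding leading_exponent_def one_class by (simp add: squarefree_exponent_def)
  moreover have "lex_monic (shifted_elementary n r 1 1 - shifted_elementary n r 0 1) (leading_exponent 1 1)"
  proof (rule lex_monic_diff)
    show "lex_monic (shifted_elementary n r 1 1) (leading_exponent 1 1)"
      using assms one_class by (intro lex_monic_shifted_elementary) auto
    fix \<beta> assume "\<beta> \<in> keys (shifted_elementary n r 0 1)"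
    then have "\<beta> \<le> leading_exponent 0 1" by (intro keys_shifted_elementary_le) auto
    also have "\<dots> < leading_exponent 1 1"
      by (rule lex_lessI[of _ 1]) (auto simp: lookup_leading_exponent parity_class_def)
    finally show "\<beta> < leading_exponent 1 1" .
  qed
  ultimately show ?thesis by simp
qed

text \<open>
  The subtracted term of the hook formula does not affect the leading monomial: its first part does
  not involve \<open>z\<^sub>2\<close> and has degree at most \<open>1\<close> in \<open>z\<^sub>1\<close>, its second part does not involve \<open>z\<^sub>1\<close>.
\<close>

lemma keys_column_odd_less:
  fixes r :: "'a::comm_ring_1"
  assumes "1 \<le> k"
    and "\<beta> \<in> keys (shifted_elementary n r 1 (k + 1) - shifted_elementary n r 0 (k + 1))"
  shows "\<beta> < single 1 1 + leading_exponent 0 k"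
proof -
  from assms(2) have "\<beta> \<in> keys (shifted_elementary n r 1 (k + 1)) \<union> keys (shifted_elementary n r 0 (k + 1))"
    by (auto simp: in_keys_iff lookup_minus)
  then have "\<beta> \<le> leading_exponent 1 (k + 1) \<or> \<beta> \<le> leading_exponent 0 (k + 1)"
    using keys_shifted_elementary_le[of 1 \<beta> n r "k + 1"] keys_shifted_elementary_le[of 0 \<beta> n r "k + 1"]
    by auto
  moreover have "leading_exponent 1 (k + 1) < single 1 1 + leading_exponent 0 k"
  proof (rule lex_lessI[of _ 2])
    show "lookup (leading_exponent 1 (k + 1)) 2 < lookup (single 1 1 + leading_exponent 0 k) 2"
      using assms(1) by (simp add: lookup_leading_exponent parity_class_def lookup_add lookup_single)
    show "lookup (leading_exponent 1 (k + 1)) j = lookup (single 1 1 + leading_exponent 0 k) j" if "j < 2" for j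
      using that by (auto simp: less_2_cases_iff lookup_leading_exponent parity_class_def lookup_add lookup_single)
  qed
  moreover have "leading_exponent 0 (k + 1) < single 1 1 + leading_exponent 0 k"
    by (rule lex_lessI[of _ 1]) (auto simp: lookup_leading_exponent parity_class_def lookup_add lookup_single)
  ultimately show ?thesis by (meson le_less_trans)
qed

lemma sum_single_const: "finite J \<Longrightarrow> (\<Sum>j\<in>J. single i 1) = (single i (card J) :: nat \<Rightarrow>\<^sub>0 nat)"
  by (induction J rule: finite_induct) (simp_all del: sum_constant flip: single_add)

theorem corollary9p5:
  fixes n a m :: nat and r :: "'a::field_char_0"
  assumes "1 \<le> n"
    and "\<forall>q::rat. q < 0 \<longrightarrow> r \<noteq> of_rat q"
    and "2 \<le> a" and "2 \<le> m" and "even m" and "m \<le> n"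
  shows "R n r (hook a (m - 1)) =
    (\<Prod>j=1..a - 2. R n r (column 1) - of_nat j) *
    (R n r (column 1) * R n r (column m)
      - const ((of_nat a - 1) / (of_nat a - 1 + of_nat m * r)) * R n r (column (m + 1)))"
proof -
  obtain k where m: "m = 2 * k" using \<open>even m\<close> by (rule evenE)
  have k: "1 \<le> k" "2 * k \<le> n" using \<open>2 \<le> m\<close> \<open>m \<le> n\<close> m by auto
  note r = assms(2)
  define R1 where "R1 = R n r (column 1)"
  define Rm where "Rm = R n r (column m)"
  define Rm1 where "Rm1 = R n r (column (m + 1))"
  define c where "c = (of_nat a - 1) / (of_nat a - 1 + of_nat m * r)"
  define p where "p = (\<Prod>j=1..a - 2. R1 - of_nat j) * (R1 * Rm - const c * Rm1)"
  have R1: "R1 = shifted_elementary n r 1 1 - shifted_elementary n r 0 1"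
    unfolding R1_def using R_column_odd[OF r, of n 0] by simp
  have Rm: "Rm = shifted_elementary n r 0 k"
    unfolding Rm_def m by (rule R_column_even[OF r k])
  have Rm1: "Rm1 = shifted_elementary n r 1 (k + 1) - shifted_elementary n r 0 (k + 1)"
    unfolding Rm1_def m by (rule R_column_odd[OF r])
  let ?l = "hook a (2 * k - 1)"
  have size_l: "odd_size n ?l = a - 2 + (1 + k)"
    using odd_size_hook[of n a "2 * k"] odd_size_column_even[OF k(2)] assms(1,3) k(1) by simp
  have R1_le: "R1 \<in> polys_le n 1"
    unfolding R1 by (intro polys_le_diff shifted_elementary_polys_le)
  have const_le: "of_nat j \<in> (polys_le n d :: 'a mpol set)" for j d
    using polys_le_const[of "of_nat j" n d] by (simp add: const_def)
  have "Rm1 \<in> polys_le n (k + 1)"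
    unfolding Rm1 by (intro polys_le_diff shifted_elementary_polys_le)
  then have "const c * Rm1 \<in> polys_le n (0 + (k + 1))" by (intro polys_le_mult polys_le_const)
  then have "const c * Rm1 \<in> polys_le n (1 + k)" by (simp add: add.commute)
  moreover have "R1 * Rm \<in> polys_le n (1 + k)"
    unfolding Rm by (intro polys_le_mult R1_le shifted_elementary_polys_le)
  ultimately have "R1 * Rm - const c * Rm1 \<in> polys_le n (1 + k)"
    by (intro polys_le_diff)
  moreover have "(\<Prod>j=1..a - 2. R1 - of_nat j) \<in> polys_le n (card {1..a - 2})"
    by (intro polys_le_prod polys_le_diff R1_le const_le)
  ultimately have "p \<in> polys_le n (card {1..a - 2} + (1 + k))"
    unfolding p_def by (intro polys_le_mult)
  then have p_le: "p \<in> polys_le n (odd_size n ?l)" using size_l by simp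
  have "R n r ?l = p"
  proof (rule R_eqI[OF r hook_in_Lambda], rule_tac [3] is_semisymI)
    show "1 \<le> a" "2 * k - 1 < n" using \<open>2 \<le> a\<close> k by auto
    show "p \<in> polys_le n (odd_size n ?l)" by (rule p_le)
    show "p \<in> invariants n"
    proof -
      have "poly_eval (shifted_elementary n r b j) (x \<circ> \<pi>) = poly_eval (shifted_elementary n r b j) x"
        if "\<pi> \<in> parity_perms n" for b j \<pi> x
        using shifted_elementary_invariant[of n r b j] that by (simp add: invariants_iff_eval)
      then show ?thesis
        using polys_le_ring[OF p_le] by (simp add: invariants_iff_eval p_def R1 Rm Rm1)
    qed
    have exponent: "bracket_exponent n ?l = single 1 (a - 1) + leading_exponent 0 k"
      using \<open>2 \<le> a\<close> k by (intro bracket_exponent_hook) auto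
    show "mdeg (bracket_exponent n ?l) = odd_size n ?l"
      unfolding exponent size_l using \<open>2 \<le> a\<close> by (simp add: mdeg_add mdeg_leading_exponent)
    show "lex_monic p (bracket_exponent n ?l)"
    proof -
      have R1_lex: "lex_monic R1 (single 1 1)"
        unfolding R1 by (rule lex_monic_column_1[OF \<open>1 \<le> n\<close>])
      have "lex_monic (R1 - of_nat j) (single 1 1)" for j
      proof (rule lex_monic_diff[OF R1_lex])
        fix \<beta> assume "\<beta> \<in> keys (of_nat j :: 'a mpol)"
        then have "\<beta> = 0" by (auto simp: in_keys_iff lookup_of_nat when_def split: if_splits)
        then show "\<beta> < single 1 1" by (intro lex_lessI[of _ 1]) (auto simp: lookup_single)
      qed
      then have "lex_monic (\<Prod>j=1..a - 2. R1 - of_nat j) (\<Sum>j=1..a - 2. single 1 1)"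
        by (intro lex_monic_prod) auto
      moreover have "(\<Sum>j=1..a - 2. single 1 1) = (single 1 (a - 2) :: nat \<Rightarrow>\<^sub>0 nat)"
        using sum_single_const[of "{1..a - 2}" 1] by (simp del: sum_constant)
      moreover have "lex_monic (R1 * Rm - const c * Rm1) (single 1 1 + leading_exponent 0 k)"
      proof (rule lex_monic_diff)
        show "lex_monic (R1 * Rm) (single 1 1 + leading_exponent 0 k)"
          unfolding Rm using k
          by (intro lex_monic_mult R1_lex lex_monic_shifted_elementary) (auto simp: parity_class_def)
        fix \<beta> assume "\<beta> \<in> keys (const c * Rm1)"
        then have "\<beta> \<in> keys Rm1"
          by (auto simp: const_def in_keys_iff map.rep_eq when_def simp flip: mult_map_scale_conv_mult)
        then show "\<beta> < single 1 1 + leading_exponent 0 k"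
          unfolding Rm1 by (rule keys_column_odd_less[OF k(1)])
      qed
      ultimately have "lex_monic p (single 1 (a - 2) + (single 1 1 + leading_exponent 0 k))"
        unfolding p_def by (metis lex_monic_mult)
      moreover have "single 1 (a - 2) + (single 1 1 + leading_exponent 0 k) = bracket_exponent n ?l"
      proof -
        have "a - 1 = a - 2 + 1" using \<open>2 \<le> a\<close> by simp
        then show ?thesis unfolding exponent by (simp only: single_add add.assoc)
      qed
      ultimately show ?thesis by simp
    qed
    fix \<mu> assume \<mu>: "\<mu> \<in> Lambda n" "odd_size n \<mu> \<le> odd_size n ?l" "\<mu> \<noteq> ?l"
    let ?x = "\<lambda>i. rho n r i + of_nat (\<mu> i)"
    define h where "h b j = shifted_value (2 * r) \<mu> (parity_support b \<mu>) j" for b j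
    define odd_sum where "odd_sum = sum \<mu> (parity_class n 1)"
    define even_sum where "even_sum = sum \<mu> (parity_class n 0)"
    define gap where "gap = odd_sum - even_sum"
    have le: "even_sum \<le> odd_sum"
      unfolding odd_sum_def even_sum_def by (rule sum_even_le_sum_odd(1)[OF \<mu>(1)])
    have "h 1 1 = of_nat odd_sum" "h 0 1 = of_nat even_sum"
      unfolding h_def shifted_value_1 odd_sum_def even_sum_def by (simp_all only: sum_parity_support[OF \<mu>(1)])
    then have R1_val: "poly_eval R1 ?x = of_nat gap"
      unfolding R1 poly_eval_diff shifted_elementary_value[OF \<mu>(1)] h_def[symmetric]
      using le by (simp add: gap_def)
    have p_val: "poly_eval p ?x =
        (\<Prod>j=1..a - 2. of_nat gap - of_nat j) * (of_nat gap * h 0 k - c * (h 1 (k + 1) - h 0 (k + 1)))"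
      by (simp add: p_def R1_val) (simp add: Rm Rm1 shifted_elementary_value[OF \<mu>(1)] h_def)
    have size: "odd_sum \<le> a - 1 + k"
      using \<mu>(2)[unfolded size_l] \<open>2 \<le> a\<close> unfolding odd_sum_def odd_size_eq_sum[symmetric] by linarith
    consider "gap = 0" | "1 \<le> gap" "gap \<le> a - 2" | "\<mu> (2 * k) = 0" | "a - 1 \<le> gap" "1 \<le> \<mu> (2 * k)"
      by linarith
    then show "poly_eval p ?x = 0"
    proof cases
      case 1
      then have "even_sum = odd_sum" using le by (simp add: gap_def)
      then have "\<mu> (Suc i) = \<mu> i" if "odd i" for i
        using that sum_even_le_sum_odd(2)[OF \<mu>(1)] unfolding odd_sum_def even_sum_def by blast
      then have "h 0 (k + 1) = h 1 (k + 1)"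
        unfolding h_def by (rule shifted_value_equal_pairs[OF \<mu>(1)])
      then show ?thesis using 1 p_val by simp
    next
      case 2
      then have "(\<Prod>j=1..a - 2. of_nat gap - of_nat j :: 'a) = 0" by (intro prod_zero bexI[of _ gap]) auto
      then show ?thesis using p_val by simp
    next
      case 3
      then have "\<mu> (2 * k + 1) = 0" "\<mu> (2 * k + 2) = 0"
        using Lambda_antimono[OF \<mu>(1), of "2 * k"] k(1) by (metis le_add1 le_zero_eq mult_le_mono one_le_numeral mult_1)+
      then have "h 0 k = 0" "h 1 (k + 1) = 0" "h 0 (k + 1) = 0"
        using 3 k(1) shifted_value_nonzeroD[OF \<mu>(1), of 0 "2 * r" k "2 * k"]
          shifted_value_nonzeroD[OF \<mu>(1), of 1 "2 * r" "k + 1" "2 * k + 1"]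
          shifted_value_nonzeroD[OF \<mu>(1), of 0 "2 * r" "k + 1" "2 * k + 2"]
        unfolding h_def by (auto simp: parity_class_def)
      then show ?thesis using p_val by simp
    next
      case 4
      have hook: "\<mu> = hook (a - 1) (2 * k)" and gap: "gap = a - 1"
        using Lambda_hook_cases[OF \<mu>(1) k 4(2) \<open>2 \<le> a\<close>] 4(1) size \<mu>(3)
        unfolding gap_def odd_sum_def even_sum_def odd_size_eq_sum by auto
      have ratio: "h 1 (k + 1) = (of_nat (a - 1) + of_nat k * (2 * r)) * h 0 k"
        unfolding h_def using \<open>2 \<le> a\<close> hook by (intro shifted_value_hook) auto
      have top: "\<mu> (2 * k + 2) = 0" using hook by (simp add: hook_def)
      have "h 0 (k + 1) = 0"
        using top shifted_value_nonzeroD[OF \<mu>(1), of 0 "2 * r" "k + 1" "2 * k + 2"]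
        unfolding h_def by (auto simp: parity_class_def)
      moreover have "of_nat m * r + of_nat (a - 1) \<noteq> 0"
        using \<open>2 \<le> a\<close> by (intro no_zero_of_not_negative_rational[OF r]) simp
      then have "c * (of_nat (a - 1) + of_nat k * (2 * r)) = of_nat (a - 1)"
        using \<open>2 \<le> a\<close> by (simp add: c_def m field_simps)
      then have "c * h 1 (k + 1) = of_nat (a - 1) * h 0 k"
        unfolding ratio mult.assoc[symmetric] by simp
      ultimately show ?thesis using p_val gap by simp
    qed
  qed
  then show ?thesis unfolding p_def R1_def Rm_def Rm1_def c_def m .
qed

end
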